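(* Let $V$ be a finite-dimensional complex vector space with a symmetric bilinear form $(-,-)$ and let $R\subset V$ be a GRRS. (i) The image of $R$ in $V/\mathrm{Ker}(-,-)$ (with the induced non-degenerate form) is a WGRS. (ii) If $R$ is irreducible and contains an isotropic root (an element $\alpha\in R$ with $(\alpha,\alpha)=0$), then $R$ is either finite or affine.
   Context: $\mathrm{Ker}(-,-)=\{v\in V:\ (v,w)=0\ \forall w\in V\}$. For $\alpha\in V$ with $(\alpha,\alpha)\ne 0$ put $r_\alpha(v):=v-\frac{2(\alpha,v)}{(\alpha,\alpha)}\alpha$. A non-empty $R\subset V$ is a generalized reflection root system (GRRS) if: (GR0) $\mathrm{Ker}(-,-)\cap R=\emptyset$; (GR1) the canonical map $\mathbb{Z}R\otimes_{\mathbb{Z}}\mathbb{C}\to V$ is a bijection ($\mathbb{Z}R$ is the additive subgroup generated by $R$); (GR2) for each $\alpha\in R$ with $(\alpha,\alpha)\neq 0$ one has $r_\alpha R=R$, and $\beta-r_\alpha\beta\in\mathbb{Z}\alpha$ for each $\beta\in R$; (GR3) for each $\alpha\in R$ with $(\alpha,\alpha)=0$ there exists an invertible map $r_\alpha:R\to R$ such that $r_\alpha(\pm\alpha)=\mp\alpha$; $r_\alpha(\beta)=\beta$ if $\beta\ne\pm\alpha$ and $(\alpha,\beta)=0$; $r_\alpha(\beta)\in\{\beta\pm\alpha\}$ if $(\alpha,\beta)\neq 0$. (WGR3) is the same as (GR3) but with the maps $r_\alpha$ not required to be invertible. A WGRS is a non-empty subset of a finite-dimensional complex space with a non-degenerate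 symmetric bilinear form satisfying (GR0), (GR1), (GR2), (WGR3). A GRRS $R$ is reducible if $R=R_1\cup R_2$ with $R_1,R_2$ non-empty and $(R_1,R_2)=0$; otherwise it is irreducible. A GRRS $R\subset V$ is affine if $R$ is infinite and the image of $R$ in $V/\mathrm{Ker}(-,-)$ is finite. *)

theory Defs
  imports "Jordan_Normal_Form.VS_Connect" "HOL-Algebra.AbelCoset" "HOL-Algebra.Free_Abelian_Groups"
begin

section \<open>Tensor products of abelian groups\<close>

text \<open>The tensor product over the integers of two commutative groups (written multiplicatively):
  the free abelian group on pairs, modulo the biadditivity relations.\<close>

definition tensor_relations ::
    "('a, 'm) monoid_scheme \<Rightarrow> ('b, 'n) monoid_scheme \<Rightarrow> ('a \<times> 'b \<Rightarrow>\<^sub>0 int) set" where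
  "tensor_relations G H =
     {frag_of (x \<otimes>\<^bsub>G\<^esub> y, c) - frag_of (x, c) - frag_of (y, c) | x y c.
        x \<in> carrier G \<and> y \<in> carrier G \<and> c \<in> carrier H} \<union>
     {frag_of (x, c \<otimes>\<^bsub>H\<^esub> d) - frag_of (x, c) - frag_of (x, d) | x c d.
        x \<in> carrier G \<and> c \<in> carrier H \<and> d \<in> carrier H}"

definition tensor_product ::
    "('a, 'm) monoid_scheme \<Rightarrow> ('b, 'n) monoid_scheme \<Rightarrow> ('a \<times> 'b \<Rightarrow>\<^sub>0 int) set monoid" where
  "tensor_product G H =
     (let F = free_Abelian_group (carrier G \<times> carrier H)
      in F Mod generate F (tensor_relations G H))"


section \<open>Complex vector spaces with a symmetric bilinear form\<close>

locale complex_form_space = vectorspace "class_ring :: complex ring" V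
  for V :: "(complex, 'v) module" +
  fixes B :: "'v \<Rightarrow> 'v \<Rightarrow> complex"
  assumes finite_dimensional: fin_dim
    and form_sym: "\<lbrakk>v \<in> carrier V; w \<in> carrier V\<rbrakk> \<Longrightarrow> B v w = B w v"
    and form_add: "\<lbrakk>u \<in> carrier V; v \<in> carrier V; w \<in> carrier V\<rbrakk>
        \<Longrightarrow> B (u \<oplus>\<^bsub>V\<^esub> v) w = B u w + B v w"
    and form_smult: "\<lbrakk>v \<in> carrier V; w \<in> carrier V\<rbrakk> \<Longrightarrow> B (c \<odot>\<^bsub>V\<^esub> v) w = c * B v w"

definition form_kernel :: "(complex, 'v) module \<Rightarrow> ('v \<Rightarrow> 'v \<Rightarrow> complex) \<Rightarrow> 'v set" where
  "form_kernel V B = {v \<in> carrier V. \<forall>w \<in> carrier V. B v w = 0}"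

definition nondegenerate :: "(complex, 'v) module \<Rightarrow> ('v \<Rightarrow> 'v \<Rightarrow> complex) \<Rightarrow> bool" where
  "nondegenerate V B \<longleftrightarrow> form_kernel V B = {\<zero>\<^bsub>V\<^esub>}"

text \<open>The quotient of a vector space by a subspace \<open>K\<close>; its vectors are the cosets of \<open>K\<close>. Adding
  \<open>K\<close> in the scalar multiplication matters only for the scalar 0. The fields \<open>mult\<close> and
  \<open>one\<close> of a module record play no role.\<close>

definition quotient_space :: "(complex, 'v) module \<Rightarrow> 'v set \<Rightarrow> (complex, 'v set) module" where
  "quotient_space V K =
     \<lparr>carrier = a_rcosets\<^bsub>V\<^esub> K, mult = undefined, one = undefined,
      ring.zero = K, ring.add = set_add V, smult = (\<lambda>c X. set_add V K ((\<lambda>v. c \<odot>\<^bsub>V\<^esub> v) ` X))\<rparr>"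

definition quotient_map :: "(complex, 'v) module \<Rightarrow> 'v set \<Rightarrow> 'v \<Rightarrow> 'v set" where
  "quotient_map V K v = K +>\<^bsub>V\<^esub> v"

text \<open>The induced form is only meaningful when \<open>B\<close> is constant on pairs of cosets.\<close>

definition quotient_form :: "('v \<Rightarrow> 'v \<Rightarrow> complex) \<Rightarrow> 'v set \<Rightarrow> 'v set \<Rightarrow> complex" where
  "quotient_form B X Y = the_elem {B x y | x y. x \<in> X \<and> y \<in> Y}"


section \<open>Generalized reflection root systems\<close>

definition int_span :: "(complex, 'v) module \<Rightarrow> 'v set \<Rightarrow> 'v set" where
  "int_span V S = generate (add_monoid V) S"

definition complexification :: "(complex, 'v) module \<Rightarrow> 'v set \<Rightarrow> ('v \<times> complex \<Rightarrow>\<^sub>0 int) set monoid" where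
  "complexification V R =
     tensor_product ((add_monoid V)\<lparr>carrier := int_span V R\<rparr>) (add_monoid (class_ring :: complex ring))"

text \<open>The additive map to \<open>V\<close> determined by sending the pure tensor of \<open>v\<close> and \<open>c\<close> to \<open>c v\<close>:
  first on formal integer combinations of pairs, then on their classes.\<close>

definition formal_evaluation :: "(complex, 'v) module \<Rightarrow> ('v \<times> complex \<Rightarrow>\<^sub>0 int) \<Rightarrow> 'v" where
  "formal_evaluation V x =
     (\<Oplus>\<^bsub>V\<^esub>p \<in> Poly_Mapping.keys x. [Poly_Mapping.lookup x p] \<cdot>\<^bsub>V\<^esub> (snd p \<odot>\<^bsub>V\<^esub> fst p))"

definition canonical_map :: "(complex, 'v) module \<Rightarrow> ('v \<times> complex \<Rightarrow>\<^sub>0 int) set \<Rightarrow> 'v" where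
  "canonical_map V X = the_elem (formal_evaluation V ` X)"

definition reflection :: "(complex, 'v) module \<Rightarrow> ('v \<Rightarrow> 'v \<Rightarrow> complex) \<Rightarrow> 'v \<Rightarrow> 'v \<Rightarrow> 'v" where
  "reflection V B \<alpha> v = v \<ominus>\<^bsub>V\<^esub> (2 * B \<alpha> v / B \<alpha> \<alpha>) \<odot>\<^bsub>V\<^esub> \<alpha>"

definition isotropic_reflection ::
    "(complex, 'v) module \<Rightarrow> ('v \<Rightarrow> 'v \<Rightarrow> complex) \<Rightarrow> 'v set \<Rightarrow> 'v \<Rightarrow> ('v \<Rightarrow> 'v) \<Rightarrow> bool" where
  "isotropic_reflection V B R \<alpha> r \<longleftrightarrow>
     r \<in> R \<rightarrow> R \<and> r \<alpha> = \<ominus>\<^bsub>V\<^esub> \<alpha> \<and> r (\<ominus>\<^bsub>V\<^esub> \<alpha>) = \<alpha> \<and>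
     (\<forall>\<beta> \<in> R. \<beta> \<noteq> \<alpha> \<and> \<beta> \<noteq> \<ominus>\<^bsub>V\<^esub> \<alpha> \<and> B \<alpha> \<beta> = 0 \<longrightarrow> r \<beta> = \<beta>) \<and>
     (\<forall>\<beta> \<in> R. B \<alpha> \<beta> \<noteq> 0 \<longrightarrow> r \<beta> \<in> {\<beta> \<oplus>\<^bsub>V\<^esub> \<alpha>, \<beta> \<ominus>\<^bsub>V\<^esub> \<alpha>})"

locale root_set = complex_form_space V B
  for V :: "(complex, 'v) module" and B +
  fixes R :: "'v set"
  assumes subset_carrier: "R \<subseteq> carrier V"
    and nonempty: "R \<noteq> {}"
    and GR0: "form_kernel V B \<inter> R = {}"
    and GR1: "bij_betw (canonical_map V) (carrier (complexification V R)) (carrier V)"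
    and GR2: "\<lbrakk>\<alpha> \<in> R; B \<alpha> \<alpha> \<noteq> 0\<rbrakk> \<Longrightarrow> reflection V B \<alpha> ` R = R \<and>
        (\<forall>\<beta> \<in> R. \<beta> \<ominus>\<^bsub>V\<^esub> reflection V B \<alpha> \<beta> \<in> int_span V {\<alpha>})"

locale grrs = root_set +
  assumes GR3: "\<lbrakk>\<alpha> \<in> R; B \<alpha> \<alpha> = 0\<rbrakk> \<Longrightarrow>
    \<exists>r. isotropic_reflection V B R \<alpha> r \<and> bij_betw r R R"

locale wgrs = root_set +
  assumes nondegenerate: "nondegenerate V B"
    and WGR3: "\<lbrakk>\<alpha> \<in> R; B \<alpha> \<alpha> = 0\<rbrakk> \<Longrightarrow> \<exists>r. isotropic_reflection V B R \<alpha> r"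

definition reducible :: "('v \<Rightarrow> 'v \<Rightarrow> complex) \<Rightarrow> 'v set \<Rightarrow> bool" where
  "reducible B R \<longleftrightarrow> (\<exists>R\<^sub>1 R\<^sub>2. R = R\<^sub>1 \<union> R\<^sub>2 \<and> R\<^sub>1 \<noteq> {} \<and> R\<^sub>2 \<noteq> {} \<and>
     (\<forall>\<alpha> \<in> R\<^sub>1. \<forall>\<beta> \<in> R\<^sub>2. B \<alpha> \<beta> = 0))"

definition affine_grrs :: "(complex, 'v) module \<Rightarrow> ('v \<Rightarrow> 'v \<Rightarrow> complex) \<Rightarrow> 'v set \<Rightarrow> bool" where
  "affine_grrs V B R \<longleftrightarrow> grrs V B R \<and> infinite R \<and> finite (quotient_map V (form_kernel V B) ` R)"

end

theory Submission
  imports Defs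
begin

text \<open>
  After passing to the quotient the form is nondegenerate.  For a nonisotropic root \<open>\<gamma>\<close> the
  functional \<open>2(\<gamma>,-)/(\<gamma>,\<gamma>)\<close> is integral on the roots.  For an isotropic root \<open>\<alpha>\<close>, either \<open>(\<alpha>,-)\<close> is
  a complex multiple of a functional that is rational on the roots, or \<open>\<alpha>\<close> meets two nonisotropic
  roots whose norms have irrational ratio, and then \<open>\<alpha>\<close> is half a signed sum of three nonisotropic
  roots.  Hence multiples of rational functionals separate points.  When scalars are expanded in a
  basis of the complex numbers over the rationals, such functionals see each coordinate of a formal
  sum separately, which gives the injectivity in (GR1).

  If the system is irreducible and has an isotropic root, then the isotropic roots span.  The integer
  \<open>2(\<gamma>,\<alpha>)/(\<gamma>,\<gamma>)\<close> has absolute value at most 2 for \<open>\<alpha>\<close> isotropic, so there are finitely many coroots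
  \<open>2\<gamma>/(\<gamma>,\<gamma>)\<close>; a coroot determines its root.  Two non-orthogonal isotropic roots pair to half the norm
  of a nonisotropic root up to sign, so there are finitely many isotropic roots as well.
\<close>

section \<open>Symmetric bilinear forms\<close>

context complex_form_space
begin

lemma form_add_right:
  "\<lbrakk>u \<in> carrier V; v \<in> carrier V; w \<in> carrier V\<rbrakk> \<Longrightarrow> B w (u \<oplus>\<^bsub>V\<^esub> v) = B w u + B w v"
  by (simp add: form_sym[of w] form_add)

lemma form_smult_right:
  "\<lbrakk>v \<in> carrier V; w \<in> carrier V\<rbrakk> \<Longrightarrow> B w (c \<odot>\<^bsub>V\<^esub> v) = c * B w v"
  by (simp add: form_sym[of w] form_smult)

lemma form_zero_left: "w \<in> carrier V \<Longrightarrow> B \<zero>\<^bsub>V\<^esub> w = 0"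
  using form_smult[of "\<zero>\<^bsub>V\<^esub>" w 0] by simp

lemma form_zero_right: "w \<in> carrier V \<Longrightarrow> B w \<zero>\<^bsub>V\<^esub> = 0"
  using form_zero_left form_sym[of w "\<zero>\<^bsub>V\<^esub>"] by simp

lemma form_uminus: "\<lbrakk>v \<in> carrier V; w \<in> carrier V\<rbrakk> \<Longrightarrow> B (\<ominus>\<^bsub>V\<^esub> v) w = - B v w"
  using form_add[of v "\<ominus>\<^bsub>V\<^esub> v" w] by (simp add: module.M.r_neg form_zero_left add_eq_0_iff)

lemma form_minus:
  "\<lbrakk>u \<in> carrier V; v \<in> carrier V; w \<in> carrier V\<rbrakk> \<Longrightarrow> B (u \<ominus>\<^bsub>V\<^esub> v) w = B u w - B v w"
  by (simp add: a_minus_def form_add form_uminus)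

lemma form_reflection:
  "\<lbrakk>u \<in> carrier V; v \<in> carrier V; w \<in> carrier V\<rbrakk>
    \<Longrightarrow> B (reflection V B u v) w = B v w - 2 * B u v / B u u * B u w"
  by (simp add: reflection_def form_minus form_smult)

end


section \<open>Rationality of root functionals\<close>

text \<open>These are the properties that pass directly to the quotient: linear spanning stands in
  for the bijection in (GR1), and (WGR3) for (GR3). When the form is nondegenerate,
  \<open>canonical_map_bij\<close> recovers the bijection from them.\<close>

locale spanning_roots = complex_form_space V B
  for V :: "(complex, 'v) module" and B +
  fixes R :: "'v set"
  assumes roots_subset: "R \<subseteq> carrier V"
    and span_roots: "span R = carrier V"
    and reflection_roots: "\<lbrakk>\<alpha> \<in> R; B \<alpha> \<alpha> \<noteq> 0\<rbrakk> \<Longrightarrow> reflection V B \<alpha> ` R = R \<and>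
        (\<forall>\<beta> \<in> R. \<beta> \<ominus>\<^bsub>V\<^esub> reflection V B \<alpha> \<beta> \<in> int_span V {\<alpha>})"
    and isotropic_roots: "\<lbrakk>\<alpha> \<in> R; B \<alpha> \<alpha> = 0\<rbrakk> \<Longrightarrow> \<exists>r. isotropic_reflection V B R \<alpha> r"
begin

section \<open>Integrality of pairings between roots\<close>

lemma root_closed [simp]: "\<alpha> \<in> R \<Longrightarrow> \<alpha> \<in> carrier V"
  using roots_subset by auto

lemma root_sym: "\<lbrakk>\<alpha> \<in> R; \<beta> \<in> R\<rbrakk> \<Longrightarrow> B \<alpha> \<beta> = B \<beta> \<alpha>"
  by (simp add: form_sym)

lemma reflection_root: "\<lbrakk>\<gamma> \<in> R; B \<gamma> \<gamma> \<noteq> 0; \<beta> \<in> R\<rbrakk> \<Longrightarrow> reflection V B \<gamma> \<beta> \<in> R"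
  using reflection_roots by blast

lemma form_int_span_singleton:
  assumes "\<alpha> \<in> carrier V" "u \<in> int_span V {\<alpha>}" "w \<in> carrier V"
  shows "u \<in> carrier V \<and> B u w / B \<alpha> w \<in> \<int>"
  using assms(2) unfolding int_span_def
proof (induction u rule: generate.induct)
  case one
  show ?case
    using assms by (simp add: form_zero_left)
next
  case (incl h)
  \<comment> \<open>Division by 0 yields 0, so the quotient is an integer also when \<alpha> and
    \<open>w\<close> are orthogonal.\<close>
  then show ?case
    using assms by (cases "B \<alpha> w = 0") auto
next
  case (inv h)
  then show ?case
    using assms by (cases "B \<alpha> w = 0") (auto simp: form_uminus a_inv_def[symmetric])
next
  case (eng h1 h2)
  then show ?case
    using assms by (auto simp: form_add add_divide_distrib)
qed

text \<open>Pairing the difference of \<beta> and its reflection with \<gamma> itself turns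
  membership in the integer multiples of \<gamma> into integrality of
  2(\<gamma>,\<beta>)/(\<gamma>,\<gamma>).\<close>

lemma cartan_integer:
  assumes "\<gamma> \<in> R" "B \<gamma> \<gamma> \<noteq> 0" "\<beta> \<in> R"
  obtains n :: int where "2 * B \<gamma> \<beta> = of_int n * B \<gamma> \<gamma>"
proof -
  have "\<beta> \<ominus>\<^bsub>V\<^esub> reflection V B \<gamma> \<beta> \<in> int_span V {\<gamma>}"
    using assms reflection_roots by blast
  then have "B (\<beta> \<ominus>\<^bsub>V\<^esub> reflection V B \<gamma> \<beta>) \<gamma> / B \<gamma> \<gamma> \<in> \<int>"
    using form_int_span_singleton[of \<gamma> _ \<gamma>] assms by simp
  moreover have "B (\<beta> \<ominus>\<^bsub>V\<^esub> reflection V B \<gamma> \<beta>) \<gamma> / B \<gamma> \<gamma> = 2 * B \<gamma> \<beta> / B \<gamma> \<gamma>"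
    using assms reflection_root[of \<gamma> \<beta>] by (simp add: form_minus form_reflection)
  ultimately obtain n where "2 * B \<gamma> \<beta> / B \<gamma> \<gamma> = of_int n"
    by (auto elim: Ints_cases)
  then show thesis
    using assms(2) by (intro that[of n]) (simp add: field_simps)
qed

text \<open>Here \<delta> is the root \<beta> + s \<alpha>. Recording it through its pairings alone
  lets later norm computations run in the complex numbers, without vector arithmetic.\<close>

lemma isotropic_step:
  assumes "\<alpha> \<in> R" "B \<alpha> \<alpha> = 0" "\<beta> \<in> R" "B \<alpha> \<beta> \<noteq> 0"
  obtains s :: int and \<delta> where "s = 1 \<or> s = - 1" "\<delta> \<in> R"
    "\<And>w. w \<in> carrier V \<Longrightarrow> B \<delta> w = B \<beta> w + of_int s * B \<alpha> w"
proof -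
  obtain r where r: "isotropic_reflection V B R \<alpha> r"
    using isotropic_roots assms by blast
  then have "r \<beta> \<in> R" "r \<beta> = \<beta> \<oplus>\<^bsub>V\<^esub> \<alpha> \<or> r \<beta> = \<beta> \<ominus>\<^bsub>V\<^esub> \<alpha>"
    using assms by (auto simp: isotropic_reflection_def)
  then show thesis
    using assms that[of 1 "r \<beta>"] that[of "-1" "r \<beta>"] by (auto simp: form_add form_minus)
qed

text \<open>The nonzero number 2(\<gamma>,\<delta>) is an integer multiple of both norms.\<close>

lemma norm_ratio_rational:
  assumes "\<gamma> \<in> R" "B \<gamma> \<gamma> \<noteq> 0" "\<delta> \<in> R" "B \<delta> \<delta> \<noteq> 0" "B \<gamma> \<delta> \<noteq> 0"
  shows "B \<gamma> \<gamma> / B \<delta> \<delta> \<in> \<rat>"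
proof -
  obtain m where m: "2 * B \<gamma> \<delta> = of_int m * B \<gamma> \<gamma>"
    using cartan_integer assms by metis
  obtain n where n: "2 * B \<gamma> \<delta> = of_int n * B \<delta> \<delta>"
    using cartan_integer assms root_sym by metis
  have "m \<noteq> 0"
    using m assms by auto
  then have "B \<gamma> \<gamma> / B \<delta> \<delta> = of_int n / of_int m"
    using m n assms by (simp add: field_simps)
  then show ?thesis
    by simp
qed

text \<open>The factor \<open>c\<close> absorbs an irrational scale: the values of the functional on
  the roots may be irrational as long as their ratios are rational.\<close>

definition rational_multiple :: "'v \<Rightarrow> bool" where
  "rational_multiple \<alpha> \<longleftrightarrow> (\<exists>c. \<forall>v\<in>R. \<exists>q\<in>\<rat>. B \<alpha> v = c * q)"

lemma nonisotropic_rational_multiple: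
  assumes "\<gamma> \<in> R" "B \<gamma> \<gamma> \<noteq> 0"
  shows "rational_multiple \<gamma>"
  unfolding rational_multiple_def
proof (intro exI[of _ "B \<gamma> \<gamma>"] ballI)
  fix v assume "v \<in> R"
  then obtain n where n: "2 * B \<gamma> v = of_int n * B \<gamma> \<gamma>"
    using cartan_integer assms by metis
  have "of_int n / 2 \<in> (\<rat> :: complex set)" "B \<gamma> v = B \<gamma> \<gamma> * (of_int n / 2)"
    using n by (simp_all add: field_simps)
  then show "\<exists>q\<in>\<rat>. B \<gamma> v = B \<gamma> \<gamma> * q"
    by blast
qed

text \<open>Each nonzero value (\<alpha>,v) is a rational multiple of the norm of a nonisotropic
  root that meets \<alpha>: of v itself, or of v \<plusminus> \<alpha> when v is isotropic. By
  \<open>comparable\<close>, one such norm serves as the common factor for all v.\<close>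

lemma isotropic_rational_multiple:
  assumes "\<alpha> \<in> R" "B \<alpha> \<alpha> = 0"
    and comparable: "\<And>\<gamma> \<delta>. \<lbrakk>\<gamma> \<in> R; \<delta> \<in> R; B \<gamma> \<gamma> \<noteq> 0; B \<delta> \<delta> \<noteq> 0; B \<alpha> \<gamma> \<noteq> 0; B \<alpha> \<delta> \<noteq> 0\<rbrakk>
      \<Longrightarrow> B \<gamma> \<gamma> / B \<delta> \<delta> \<in> \<rat>"
  shows "rational_multiple \<alpha>"
proof -
  have ex: "\<exists>\<gamma>\<in>R. B \<gamma> \<gamma> \<noteq> 0 \<and> B \<alpha> \<gamma> \<noteq> 0 \<and> (\<exists>q\<in>\<rat>. B \<alpha> v = B \<gamma> \<gamma> * q)"
    if v: "v \<in> R" "B \<alpha> v \<noteq> 0" for v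
  proof (cases "B v v = 0")
    case True
    obtain s \<delta> where s: "s = 1 \<or> s = - 1" and \<delta>: "\<delta> \<in> R"
      "\<And>w. w \<in> carrier V \<Longrightarrow> B \<delta> w = B v w + of_int s * B \<alpha> w"
      using isotropic_step assms v by metis
    have a: "B \<delta> \<alpha> = B \<alpha> v"
      using \<delta> assms v root_sym[of v \<alpha>] by simp
    have "B \<delta> v = of_int s * B \<alpha> v"
      using \<delta> v True by simp
    \<comment> \<open>Both \<open>v\<close> and \<alpha> are isotropic, so only the cross term of
      the norm remains.\<close>
    then have "B \<delta> \<delta> = 2 * of_int s * B \<alpha> v"
      using \<delta>(2)[of \<delta>] \<delta>(1) a root_sym[of \<delta> \<alpha>] root_sym[of \<delta> v] assms v by simp
    moreover have "of_int s / 2 \<in> (\<rat> :: complex set)"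
      by simp
    ultimately show ?thesis
      using s v a \<delta>(1) assms root_sym[of \<delta> \<alpha>]
      by (intro bexI[of _ \<delta>] conjI bexI[of _ "of_int s / 2"]) auto
  next
    case False
    then obtain n where "2 * B v \<alpha> = of_int n * B v v"
      using cartan_integer assms v by metis
    then have "B \<alpha> v = B v v * (of_int n / 2)"
      using root_sym[of v \<alpha>] v assms by (simp add: field_simps)
    then show ?thesis
      using v False by (intro bexI[of _ v] conjI bexI[of _ "of_int n / 2"]) auto
  qed
  show ?thesis
  proof (cases "\<exists>\<gamma>\<in>R. B \<gamma> \<gamma> \<noteq> 0 \<and> B \<alpha> \<gamma> \<noteq> 0")
    case True
    then obtain \<gamma> where \<gamma>: "\<gamma> \<in> R" "B \<gamma> \<gamma> \<noteq> 0" "B \<alpha> \<gamma> \<noteq> 0"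
      by blast
    have "\<exists>q\<in>\<rat>. B \<alpha> v = B \<gamma> \<gamma> * q" if v: "v \<in> R" for v
    proof (cases "B \<alpha> v = 0")
      case False
      then obtain \<delta> q where \<delta>: "\<delta> \<in> R" "B \<delta> \<delta> \<noteq> 0" "B \<alpha> \<delta> \<noteq> 0" "q \<in> \<rat>" "B \<alpha> v = B \<delta> \<delta> * q"
        using ex[OF v] by blast
      then have "B \<delta> \<delta> / B \<gamma> \<gamma> * q \<in> \<rat>"
        using comparable[of \<delta> \<gamma>] \<gamma> by (intro Rats_mult) auto
      moreover have "B \<alpha> v = B \<gamma> \<gamma> * (B \<delta> \<delta> / B \<gamma> \<gamma> * q)"
        using \<gamma> \<delta> by simp
      ultimately show ?thesis
        by blast
    qed (auto intro: bexI[of _ 0])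
    then show ?thesis
      unfolding rational_multiple_def by blast
  next
    case False
    \<comment> \<open>Without a nonisotropic root that meets \<alpha>, \<open>ex\<close> forces the
      functional to vanish on \<open>R\<close>, and 0 serves as the factor.\<close>
    then have "B \<alpha> v = 0 * 0" if "v \<in> R" for v
      using ex[OF that] by auto
    then show ?thesis
      unfolding rational_multiple_def by (metis Rats_0)
  qed
qed

text \<open>The irrational ratio makes \<gamma> and \<delta> orthogonal, so \<epsilon> = \<gamma>
  \<plusminus> \<alpha> pairs with \<delta> through \<alpha> alone, hence nontrivially. The norm of
  \<epsilon> is 1 + s n times that of \<gamma>. Were it nonzero, its ratio to the norm of \<delta>
  would be rational, and so would the ratio for \<gamma>. Hence 1 + s n = 0.\<close>

lemma isotropic_reflection_unit:
  assumes \<alpha>: "\<alpha> \<in> R" "B \<alpha> \<alpha> = 0"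
    and \<gamma>: "\<gamma> \<in> R" "B \<gamma> \<gamma> \<noteq> 0" "B \<alpha> \<gamma> \<noteq> 0"
    and \<delta>: "\<delta> \<in> R" "B \<delta> \<delta> \<noteq> 0" "B \<alpha> \<delta> \<noteq> 0"
    and irr: "B \<gamma> \<gamma> / B \<delta> \<delta> \<notin> \<rat>"
  obtains n :: int where "n = 1 \<or> n = - 1" "2 * B \<gamma> \<alpha> = of_int n * B \<gamma> \<gamma>"
proof -
  obtain n where n: "2 * B \<gamma> \<alpha> = of_int n * B \<gamma> \<gamma>"
    using cartan_integer assms by metis
  have orth: "B \<gamma> \<delta> = 0"
    using norm_ratio_rational[of \<gamma> \<delta>] assms by blast
  obtain s \<epsilon> where s: "s = 1 \<or> s = - 1" and \<epsilon>: "\<epsilon> \<in> R"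
    "\<And>w. w \<in> carrier V \<Longrightarrow> B \<epsilon> w = B \<gamma> w + of_int s * B \<alpha> w"
    using isotropic_step[OF \<alpha> \<gamma>(1,3)] by metis
  have "B \<epsilon> \<alpha> = B \<gamma> \<alpha>"
    using \<epsilon>(2)[of \<alpha>] \<alpha> by simp
  moreover have "B \<epsilon> \<gamma> = B \<gamma> \<gamma> + of_int s * B \<gamma> \<alpha>"
    using \<epsilon>(2)[of \<gamma>] \<alpha> \<gamma> root_sym[of \<gamma> \<alpha>] by simp
  ultimately have "B \<epsilon> \<epsilon> = B \<gamma> \<gamma> + 2 * of_int s * B \<gamma> \<alpha>"
    using \<epsilon>(2)[of \<epsilon>] \<epsilon>(1) root_sym[of \<epsilon> \<alpha>] root_sym[of \<epsilon> \<gamma>] \<alpha> \<gamma> by simp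
  then have norm: "B \<epsilon> \<epsilon> = of_int (1 + s * n) * B \<gamma> \<gamma>"
    using n by (simp add: algebra_simps)
  have "1 + s * n = 0"
  proof (rule ccontr)
    assume nz: "1 + s * n \<noteq> 0"
    then have "B \<epsilon> \<epsilon> \<noteq> 0"
      using norm \<gamma> by (metis mult_eq_0_iff of_int_eq_0_iff)
    moreover have "B \<epsilon> \<delta> \<noteq> 0"
      using \<epsilon>(2)[of \<delta>] \<delta> orth s by auto
    ultimately have "B \<epsilon> \<epsilon> / B \<delta> \<delta> \<in> \<rat>"
      using norm_ratio_rational \<epsilon> \<delta> by blast
    then have "B \<epsilon> \<epsilon> / B \<delta> \<delta> / of_int (1 + s * n) \<in> \<rat>"
      by (rule Rats_divide) simp
    moreover have "B \<epsilon> \<epsilon> / B \<delta> \<delta> / of_int (1 + s * n) = B \<gamma> \<gamma> / B \<delta> \<delta>"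
    proof -
      have "of_int (1 + s * n) \<noteq> (0 :: complex)"
        using nz by (simp only: of_int_eq_0_iff not_False_eq_True)
      moreover have "k \<noteq> 0 \<Longrightarrow> k * x / y / k = x / y" for k x y :: complex
        by simp
      ultimately show ?thesis
        unfolding norm by blast
    qed
    ultimately show False
      using irr by simp
  qed
  then have "n = 1 \<or> n = - 1"
    using s by auto
  then show thesis
    using n that by blast
qed

text \<open>Irrational ratios do occur: in the root system D(2,1;a) with a irrational.  There
  \<open>r_\<alpha>\<close> maps the isotropic root \<open>\<alpha> - m \<gamma> - n \<delta>\<close> to \<open>2 \<alpha> - m \<gamma> - n \<delta>\<close>, a nonisotropic root.\<close>

lemma isotropic_root_functional:
  assumes \<alpha>: "\<alpha> \<in> R" "B \<alpha> \<alpha> = 0" and "\<not> rational_multiple \<alpha>"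
  shows "\<exists>\<gamma>\<^sub>1\<in>R. \<exists>\<gamma>\<^sub>2\<in>R. \<exists>\<gamma>\<^sub>3\<in>R. \<exists>a b c.
    B \<gamma>\<^sub>1 \<gamma>\<^sub>1 \<noteq> 0 \<and> B \<gamma>\<^sub>2 \<gamma>\<^sub>2 \<noteq> 0 \<and> B \<gamma>\<^sub>3 \<gamma>\<^sub>3 \<noteq> 0 \<and>
    (\<forall>w\<in>carrier V. B \<alpha> w = a * B \<gamma>\<^sub>1 w + b * B \<gamma>\<^sub>2 w + c * B \<gamma>\<^sub>3 w)"
proof -
  obtain \<gamma> \<delta> where \<gamma>: "\<gamma> \<in> R" "B \<gamma> \<gamma> \<noteq> 0" "B \<alpha> \<gamma> \<noteq> 0"
    and \<delta>: "\<delta> \<in> R" "B \<delta> \<delta> \<noteq> 0" "B \<alpha> \<delta> \<noteq> 0" and irr: "B \<gamma> \<gamma> / B \<delta> \<delta> \<notin> \<rat>"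
    using isotropic_rational_multiple[OF \<alpha>] assms(3) by blast
  define x y where "x = B \<gamma> \<gamma>" and "y = B \<delta> \<delta>"
  \<comment> \<open>The inverse ratio is needed to apply \<open>isotropic_reflection_unit\<close>
    with \<gamma> and \<delta> exchanged.\<close>
  have irr': "y / x \<notin> \<rat>"
  proof
    assume "y / x \<in> \<rat>"
    then have "1 / (y / x) \<in> \<rat>"
      by (rule Rats_divide[OF Rats_1])
    then show False
      using irr by (simp add: x_def y_def)
  qed
  have orth: "B \<gamma> \<delta> = 0" "B \<delta> \<gamma> = 0"
    using norm_ratio_rational[of \<gamma> \<delta>] \<gamma> \<delta> irr root_sym[of \<gamma> \<delta>] by auto
  obtain m :: int where m: "m = 1 \<or> m = - 1" "2 * B \<gamma> \<alpha> = of_int m * x"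
    using isotropic_reflection_unit[OF \<alpha> \<gamma> \<delta> irr] x_def by metis
  obtain n :: int where n: "n = 1 \<or> n = - 1" "2 * B \<delta> \<alpha> = of_int n * y"
    using isotropic_reflection_unit[OF \<alpha> \<delta> \<gamma>] irr' x_def y_def by metis
  have mm: "of_int m * of_int m = (1 :: complex)" and nn: "of_int n * of_int n = (1 :: complex)"
    using m n by auto
  have x0: "x \<noteq> 0" and y0: "y \<noteq> 0" and xy: "x + y \<noteq> 0"
  proof -
    show "x \<noteq> 0" "y \<noteq> 0"
      using \<gamma> \<delta> by (auto simp: x_def y_def)
    \<comment> \<open>Up to sign this is the norm of the third root; it cannot vanish because -1 is
      rational.\<close>
    show "x + y \<noteq> 0"
    proof
      assume "x + y = 0"
      then have "y / x = - 1"
        using \<open>x \<noteq> 0\<close> by (simp add: field_simps eq_neg_iff_add_eq_0)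
      then show False
        using irr' by simp
    qed
  qed
  \<comment> \<open>By orthogonality of \<gamma> and \<delta>, this root is \<alpha> - m \<gamma> -
    n \<delta>, with the signs \<open>m\<close> and \<open>n\<close> just found.\<close>
  define \<beta> where "\<beta> = reflection V B \<delta> (reflection V B \<gamma> \<alpha>)"
  have \<beta>: "\<beta> \<in> R"
    using \<alpha> \<gamma> \<delta> by (simp add: \<beta>_def reflection_root)
  have g: "2 * B \<gamma> \<alpha> / x = of_int m" "2 * B \<delta> \<alpha> / y = of_int n"
    using m n x0 y0 by simp_all
  have "B \<delta> (reflection V B \<gamma> \<alpha>) = B \<delta> \<alpha>"
    using \<alpha> \<gamma> \<delta> orth root_sym[of \<delta> "reflection V B \<gamma> \<alpha>"] root_sym[of \<delta> \<alpha>]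
    by (simp add: reflection_root form_reflection)
  then have B\<beta>: "B \<beta> w = B \<alpha> w - of_int m * B \<gamma> w - of_int n * B \<delta> w" if "w \<in> carrier V" for w
    using that \<alpha> \<gamma> \<delta> g unfolding \<beta>_def
    by (simp add: reflection_root form_reflection x_def[symmetric] y_def[symmetric])
  have "2 * B \<beta> \<alpha> = - of_int m * (2 * B \<gamma> \<alpha>) - of_int n * (2 * B \<delta> \<alpha>)"
    using B\<beta>[of \<alpha>] \<alpha> by simp
  also have "\<dots> = - (x + y)"
    using mm nn by (simp add: m(2) n(2) mult.assoc[symmetric])
  finally have \<beta>\<alpha>: "2 * B \<beta> \<alpha> = - (x + y)" .
  then have "B \<alpha> \<beta> \<noteq> 0"
    using xy root_sym[of \<alpha> \<beta>] \<alpha> \<beta> by auto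
  then obtain s \<epsilon> where s: "s = 1 \<or> s = - 1" and \<epsilon>: "\<epsilon> \<in> R"
    "\<And>w. w \<in> carrier V \<Longrightarrow> B \<epsilon> w = B \<beta> w + of_int s * B \<alpha> w"
    using isotropic_step[OF \<alpha> \<beta>] by metis
  \<comment> \<open>Reflections are isometries, so \<beta> is isotropic like \<alpha>; the
    computation uses only the formula for its pairings.\<close>
  have \<beta>\<beta>: "B \<beta> \<beta> = 0"
  proof -
    have "2 * B \<beta> \<gamma> = 2 * B \<gamma> \<alpha> - 2 * of_int m * x" "2 * B \<beta> \<delta> = 2 * B \<delta> \<alpha> - 2 * of_int n * y"
      using B\<beta>[of \<gamma>] B\<beta>[of \<delta>] orth \<alpha> \<gamma> \<delta> root_sym[of \<gamma> \<alpha>] root_sym[of \<delta> \<alpha>]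
      by (simp_all add: x_def y_def right_diff_distrib)
    then have "2 * B \<beta> \<gamma> = - of_int m * x" "2 * B \<beta> \<delta> = - of_int n * y"
      unfolding m(2) n(2) by simp_all
    then have "B \<beta> \<gamma> = - of_int m * x / 2" "B \<beta> \<delta> = - of_int n * y / 2"
      by (simp_all add: field_simps)
    then have "2 * B \<beta> \<beta> = - (x + y) + (of_int m * of_int m) * x + (of_int n * of_int n) * y"
      using B\<beta>[of \<beta>] \<beta> \<beta>\<alpha> root_sym[of \<beta> \<alpha>] root_sym[of \<beta> \<gamma>] root_sym[of \<beta> \<delta>] \<alpha> \<gamma> \<delta>
      by (simp add: algebra_simps)
    then show ?thesis
      using mm nn by simp
  qed
  have "B \<epsilon> \<alpha> = B \<beta> \<alpha>" "B \<epsilon> \<beta> = of_int s * B \<beta> \<alpha>"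
    using \<epsilon>(2)[of \<alpha>] \<epsilon>(2)[of \<beta>] \<alpha> \<beta> \<beta>\<beta> root_sym[of \<beta> \<alpha>] by simp_all
  then have "B \<epsilon> \<epsilon> = of_int s * (2 * B \<beta> \<alpha>)"
    using \<epsilon>(2)[of \<epsilon>] \<epsilon>(1) root_sym[of \<epsilon> \<alpha>] root_sym[of \<epsilon> \<beta>] \<alpha> \<beta> by simp
  then have norm: "B \<epsilon> \<epsilon> = - of_int s * (x + y)"
    unfolding \<beta>\<alpha> by (simp add: algebra_simps)
  then have \<epsilon>0: "B \<epsilon> \<epsilon> \<noteq> 0"
    using s xy by auto
  \<comment> \<open>The other sign would make \<epsilon> = - m \<gamma> - n \<delta> a root of norm
    x + y that is not orthogonal to \<gamma>, so 1 + y/x would be rational.\<close>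
  have "s = 1"
  proof (rule ccontr)
    assume "s \<noteq> 1"
    then have "s = - 1"
      using s by simp
    then have "B \<epsilon> \<gamma> = - of_int m * x"
      using \<epsilon>(2)[of \<gamma>] B\<beta>[of \<gamma>] \<gamma> orth x_def by simp
    then have "B \<epsilon> \<epsilon> / B \<gamma> \<gamma> \<in> \<rat>"
      using \<epsilon> \<epsilon>0 \<gamma> m x0 by (intro norm_ratio_rational) auto
    moreover have "B \<epsilon> \<epsilon> / B \<gamma> \<gamma> = 1 + y / x"
      using norm \<open>s = - 1\<close> x0 by (simp add: x_def add_divide_distrib)
    ultimately have "1 + y / x - 1 \<in> \<rat>"
      by (intro Rats_diff) auto
    then show False
      using irr' by simp
  qed
  \<comment> \<open>The equation \<epsilon> = 2 \<alpha> - m \<gamma> - n \<delta> is solved for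
    \<alpha>.\<close>
  have "B \<alpha> w = of_int m / 2 * B \<gamma> w + of_int n / 2 * B \<delta> w + 1 / 2 * B \<epsilon> w" if "w \<in> carrier V" for w
    using \<epsilon>(2)[OF that] B\<beta>[OF that] \<open>s = 1\<close> by (simp add: field_simps)
  then show ?thesis
    using \<gamma> \<delta> \<epsilon>(1) \<epsilon>0 by blast
qed

end


section \<open>Finiteness\<close>

lemma (in complex_form_space) orthogonal_submodule:
  assumes "u \<in> carrier V"
  shows "LinearCombinations.submodule class_ring {v \<in> carrier V. B u v = 0} V"
  using assms
  by (auto simp: LinearCombinations.submodule_def form_zero_right form_add_right form_smult_right module.module_axioms)

lemma (in complex_form_space) orthogonal_span:
  assumes "u \<in> carrier V" "S \<subseteq> carrier V" "\<And>v. v \<in> S \<Longrightarrow> B u v = 0" "w \<in> span S"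
  shows "B u w = 0"
  using span_is_subset[OF _ orthogonal_submodule[OF assms(1)], of S] assms by blast

text \<open>A finite spanning set involves only finitely many elements of \<open>S\<close>. Applied
  to the isotropic roots, this yields finitely many test vectors.\<close>

lemma (in complex_form_space) finite_spanning_subset:
  assumes S: "S \<subseteq> carrier V" "span S = carrier V"
  obtains F where "finite F" "F \<subseteq> S" "span F = carrier V"
proof -
  obtain A where A: "finite A" "A \<subseteq> carrier V" "span A = carrier V"
    using finite_dimensional unfolding fin_dim_def by blast
  have "\<exists>F. finite F \<and> F \<subseteq> S \<and> a \<in> span F" if "a \<in> A" for a
  proof -
    have "a \<in> span S"
      using subsetD[OF A(2) that] S(2) by simp
    then obtain c F where "a = lincomb c F" "finite F" "F \<subseteq> S" "c \<in> F \<rightarrow> carrier class_ring"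
      unfolding span_def by blast
    then show ?thesis
      unfolding span_def by blast
  qed
  then obtain F where F: "\<And>a. a \<in> A \<Longrightarrow> finite (F a) \<and> F a \<subseteq> S \<and> a \<in> span (F a)"
    by metis
  show thesis
  proof
    show "finite (\<Union>a\<in>A. F a)" and sub: "(\<Union>a\<in>A. F a) \<subseteq> S"
      using A F by auto
    have "A \<subseteq> span (\<Union>a\<in>A. F a)"
      using F span_is_monotone[of "F _" "\<Union>a\<in>A. F a"] by blast
    then have "span A \<subseteq> span (\<Union>a\<in>A. F a)"
      using sub S by (intro span_is_subset span_is_submodule) auto
    then show "span (\<Union>a\<in>A. F a) = carrier V"
      using A(3) span_is_subset2[OF subset_trans[OF sub S(1)]] by simp
  qed
qed

text \<open>The difference is orthogonal to \<open>S\<close>, hence to its span, and so lies in the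
  zero kernel.\<close>

lemma (in complex_form_space) nondegenerate_eqI:
  assumes nondeg: "nondegenerate V B" and S: "S \<subseteq> carrier V" "span S = carrier V"
    and uv: "u \<in> carrier V" "v \<in> carrier V" "\<And>s. s \<in> S \<Longrightarrow> B u s = B v s"
  shows "u = v"
proof -
  have "B (u \<ominus>\<^bsub>V\<^esub> v) w = 0" if "w \<in> carrier V" for w
  proof (rule orthogonal_span[OF _ S(1)])
    show "w \<in> span S"
      using that S(2) by simp
    show "B (u \<ominus>\<^bsub>V\<^esub> v) s = 0" if "s \<in> S" for s
      using uv subsetD[OF S(1) that] that by (simp add: form_minus)
  qed (use uv in simp)
  then have "u \<ominus>\<^bsub>V\<^esub> v \<in> form_kernel V B"
    using uv by (simp add: form_kernel_def)
  then show ?thesis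
    using nondeg uv by (simp add: nondegenerate_def)
qed

section \<open>Bounded Cartan integers and finiteness of irreducible systems\<close>

context spanning_roots
begin

text \<open>The root \<delta> = \<gamma> + s \<alpha> pairs with \<alpha> as \<gamma> does, and its
  norm is 1 + s n times that of \<gamma>. If it is isotropic, n is 1 or -1. Otherwise integrality
  for \<delta> gives n = m (1 + s n), which makes 1 + s n a unit of the integers, so n is 0 or -2
  s.\<close>

lemma isotropic_cartan_integer:
  assumes \<alpha>: "\<alpha> \<in> R" "B \<alpha> \<alpha> = 0" and \<gamma>: "\<gamma> \<in> R" "B \<gamma> \<gamma> \<noteq> 0"
  obtains n :: int where "n \<in> {-2..2}" "2 * B \<gamma> \<alpha> = of_int n * B \<gamma> \<gamma>"
proof -
  obtain n where n: "2 * B \<gamma> \<alpha> = of_int n * B \<gamma> \<gamma>"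
    using cartan_integer assms by metis
  have "n \<in> {-2..2}"
  proof (cases "n = 0")
    case False
    then have "B \<alpha> \<gamma> \<noteq> 0"
      using n \<gamma> root_sym[of \<alpha> \<gamma>] \<alpha> by auto
    then obtain s \<delta> where s: "s = 1 \<or> s = - 1" and \<delta>: "\<delta> \<in> R"
      "\<And>w. w \<in> carrier V \<Longrightarrow> B \<delta> w = B \<gamma> w + of_int s * B \<alpha> w"
      using isotropic_step[OF \<alpha> \<gamma>(1)] by metis
    have a: "B \<delta> \<alpha> = B \<gamma> \<alpha>"
      using \<delta>(2)[of \<alpha>] \<alpha> by simp
    moreover have "B \<delta> \<gamma> = B \<gamma> \<gamma> + of_int s * B \<gamma> \<alpha>"
      using \<delta>(2)[of \<gamma>] \<alpha> \<gamma> root_sym[of \<gamma> \<alpha>] by simp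
    ultimately have "B \<delta> \<delta> = B \<gamma> \<gamma> + of_int s * (2 * B \<gamma> \<alpha>)"
      using \<delta>(2)[of \<delta>] \<delta>(1) root_sym[of \<delta> \<alpha>] root_sym[of \<delta> \<gamma>] \<alpha> \<gamma> by simp
    then have norm: "B \<delta> \<delta> = of_int (1 + s * n) * B \<gamma> \<gamma>"
      using n by (simp add: algebra_simps)
    show ?thesis
    proof (cases "1 + s * n = 0")
      case True
      then show ?thesis
        using s by auto
    next
      case nz: False
      then have "B \<delta> \<delta> \<noteq> 0"
        using norm \<gamma> by (metis mult_eq_0_iff of_int_eq_0_iff)
      then obtain m where "2 * B \<delta> \<alpha> = of_int m * B \<delta> \<delta>"
        using cartan_integer \<delta> \<alpha> by metis
      then have "of_int n * B \<gamma> \<gamma> = of_int (m * (1 + s * n)) * B \<gamma> \<gamma>"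
        using a n norm by simp
      then have nm: "n = m * (1 + s * n)"
        using \<gamma> by (metis mult_right_cancel of_int_eq_iff)
      have "(1 + s * n) * (1 - s * m) = 1"
      proof -
        have "(1 + s * n) * (1 - s * m) = 1 + s * (n - m * (1 + s * n))"
          by (simp add: algebra_simps)
        also have "n - m * (1 + s * n) = 0"
          using nm by simp
        finally show ?thesis
          by simp
      qed
      then have "1 + s * n = 1 \<or> 1 + s * n = - 1"
        by (meson zmult_eq_1_iff)
      then show ?thesis
        using s False by auto
    qed
  qed simp
  then show thesis
    using n that by blast
qed

text \<open>Suppose that a root \<gamma> outside the span of the isotropic roots meets an isotropic
  \<beta>. The reflection of \<beta> in \<gamma> is again isotropic and differs from \<beta> by a
  nonzero multiple of \<gamma>, which puts \<gamma> into the span. So the roots outside are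
  orthogonal to those inside, and irreducibility leaves none outside.\<close>

lemma isotropic_roots_span:
  assumes irr: "\<not> reducible B R" and "\<alpha> \<in> R" "B \<alpha> \<alpha> = 0"
  shows "span {\<alpha> \<in> R. B \<alpha> \<alpha> = 0} = carrier V"
proof -
  define I where "I = {\<alpha> \<in> R. B \<alpha> \<alpha> = 0}"
  have I: "I \<subseteq> R" "I \<subseteq> carrier V"
    using roots_subset by (auto simp: I_def)
  have sub: "LinearCombinations.submodule class_ring (span I) V"
    by (rule span_is_submodule[OF I(2)])
  have I_span: "I \<subseteq> span I"
    by (rule in_own_span[OF I(2)])
  have orth: "B \<beta> \<gamma> = 0" if \<gamma>: "\<gamma> \<in> R" "\<gamma> \<notin> span I" and \<beta>: "\<beta> \<in> I" for \<beta> \<gamma>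
  proof (rule ccontr)
    assume nz: "B \<beta> \<gamma> \<noteq> 0"
    have \<beta>R: "\<beta> \<in> R" "B \<beta> \<beta> = 0"
      using \<beta> by (auto simp: I_def)
    have g: "B \<gamma> \<gamma> \<noteq> 0"
      using \<gamma> I_span by (auto simp: I_def)
    define c where "c = 2 * B \<gamma> \<beta> / B \<gamma> \<gamma>"
    have c: "c \<noteq> 0"
      using nz g \<beta>R \<gamma> root_sym[of \<gamma> \<beta>] by (simp add: c_def)
    have r: "reflection V B \<gamma> \<beta> \<in> R"
      using \<gamma> g \<beta>R by (simp add: reflection_root)
    moreover have "B (reflection V B \<gamma> \<beta>) (reflection V B \<gamma> \<beta>) = 0"
    proof -
      define \<rho> where "\<rho> = reflection V B \<gamma> \<beta>"
      have \<rho>: "B \<rho> w = B \<beta> w - c * B \<gamma> w" if "w \<in> carrier V" for w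
        using that \<gamma> \<beta>R by (simp add: \<rho>_def form_reflection c_def)
      have "\<rho> \<in> R"
        using r by (simp add: \<rho>_def)
      moreover have "B \<rho> \<beta> = - c * B \<gamma> \<beta>" "B \<rho> \<gamma> = - B \<gamma> \<beta>"
        using \<rho>[of \<beta>] \<rho>[of \<gamma>] \<gamma> \<beta>R g root_sym[of \<gamma> \<beta>] by (simp_all add: c_def)
      ultimately have "B \<rho> \<rho> = 0"
        using \<rho>[of \<rho>] \<gamma> \<beta>R root_sym[of \<rho> \<beta>] root_sym[of \<rho> \<gamma>] by simp
      then show ?thesis
        by (simp add: \<rho>_def)
    qed
    ultimately have "reflection V B \<gamma> \<beta> \<in> span I"
      using I_span by (auto simp: I_def)
    \<comment> \<open>The reflection of \<beta> is \<beta> - c \<gamma>; this is solved for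
      \<gamma>.\<close>
    moreover have "\<gamma> = (- 1 / c) \<odot>\<^bsub>V\<^esub> (reflection V B \<gamma> \<beta> \<oplus>\<^bsub>V\<^esub> (- 1) \<odot>\<^bsub>V\<^esub> \<beta>)"
    proof -
      have "reflection V B \<gamma> \<beta> = \<beta> \<oplus>\<^bsub>V\<^esub> (- c) \<odot>\<^bsub>V\<^esub> \<gamma>"
        using \<gamma> \<beta>R module.smult_l_minus[of c \<gamma>]
        by (simp add: reflection_def c_def a_minus_def class_ring_simps)
      moreover have "(- 1) \<odot>\<^bsub>V\<^esub> \<beta> = \<ominus>\<^bsub>V\<^esub> \<beta>"
        using \<beta>R module.smult_l_minus[of 1 \<beta>] module.smult_one[of \<beta>] by (simp add: class_ring_simps)
      ultimately have "reflection V B \<gamma> \<beta> \<oplus>\<^bsub>V\<^esub> (- 1) \<odot>\<^bsub>V\<^esub> \<beta> = (- c) \<odot>\<^bsub>V\<^esub> \<gamma>"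
        using \<gamma> \<beta>R by (simp add: module.M.a_ac module.M.r_neg2)
      then show ?thesis
        using c \<gamma> module.smult_assoc1[of "- 1 / c" "- c" \<gamma>] module.smult_one[of \<gamma>] by simp
    qed
    moreover have "(- 1 / c) \<odot>\<^bsub>V\<^esub> (\<rho> \<oplus>\<^bsub>V\<^esub> (- 1) \<odot>\<^bsub>V\<^esub> \<beta>) \<in> span I" if "\<rho> \<in> span I" for \<rho>
      using that subsetD[OF I_span \<beta>] LinearCombinations.submodule.m_closed[OF sub]
        LinearCombinations.submodule.smult_closed[OF sub] by simp
    ultimately have "\<gamma> \<in> span I"
      by metis
    then show False
      using \<gamma> by blast
  qed
  \<comment> \<open>Orthogonality extends linearly from the isotropic roots to every root in their
    span.\<close>
  have "B \<beta> \<gamma> = 0" if "\<gamma> \<in> R - span I" "\<beta> \<in> R \<inter> span I" for \<beta> \<gamma>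
  proof -
    have "B \<gamma> \<beta> = 0"
    proof (rule orthogonal_span[OF _ I(2)])
      show "B \<gamma> v = 0" if "v \<in> I" for v
        using orth[of \<gamma> v] that \<open>\<gamma> \<in> R - span I\<close> I(1) root_sym[of \<gamma> v] by auto
    qed (use that in simp_all)
    then show ?thesis
      using that root_sym[of \<gamma> \<beta>] by simp
  qed
  moreover have "R = (R \<inter> span I) \<union> (R - span I)" "R \<inter> span I \<noteq> {}"
    using I_span assms by (auto simp: I_def)
  ultimately have "R - span I = {}"
    using irr unfolding reducible_def by meson
  then have "span R \<subseteq> span I"
    using span_is_subset[OF _ sub, of R] by (simp only: Diff_eq_empty_iff)
  then show ?thesis
    using span_roots span_is_subset2[OF I(2)] unfolding I_def by (simp only: subset_antisym)
qed

theorem finite_roots: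
  assumes nondeg: "nondegenerate V B" and irr: "\<not> reducible B R" and iso: "\<exists>\<alpha>\<in>R. B \<alpha> \<alpha> = 0"
  shows "finite R"
proof -
  define I where "I = {\<alpha> \<in> R. B \<alpha> \<alpha> = 0}"
  define N where "N = {\<gamma> \<in> R. B \<gamma> \<gamma> \<noteq> 0}"
  have "span I = carrier V" "I \<subseteq> carrier V"
    using isotropic_roots_span[OF irr] iso roots_subset by (auto simp: I_def)
  then obtain J where J: "finite J" "J \<subseteq> I" "span J = carrier V"
    using finite_spanning_subset by metis
  then have JV: "J \<subseteq> carrier V"
    using \<open>I \<subseteq> carrier V\<close> by auto
  have "finite N"
  proof (rule inj_on_finite)
    \<comment> \<open>The map records the values of the coroot on the finite spanning set
      \<open>J\<close>; restricting to \<open>J\<close> places it in a finite set of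
      functions.\<close>
    show "inj_on (\<lambda>\<gamma>. \<lambda>\<beta>\<in>J. 2 * B \<gamma> \<beta> / B \<gamma> \<gamma>) N"
    proof (rule inj_onI)
      fix \<gamma> \<delta> assume \<gamma>: "\<gamma> \<in> N" and \<delta>: "\<delta> \<in> N"
        and eq: "(\<lambda>\<beta>\<in>J. 2 * B \<gamma> \<beta> / B \<gamma> \<gamma>) = (\<lambda>\<beta>\<in>J. 2 * B \<delta> \<beta> / B \<delta> \<delta>)"
      define c where "c = B \<gamma> \<gamma> / B \<delta> \<delta>"
      have c: "c \<noteq> 0"
        using \<gamma> \<delta> by (simp add: c_def N_def)
      have V: "\<gamma> \<in> carrier V" "\<delta> \<in> carrier V" and nz: "B \<gamma> \<gamma> \<noteq> 0" "B \<delta> \<delta> \<noteq> 0"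
        using \<gamma> \<delta> by (auto simp: N_def)
      have "B \<gamma> \<beta> = B (c \<odot>\<^bsub>V\<^esub> \<delta>) \<beta>" if "\<beta> \<in> J" for \<beta>
      proof -
        have "2 * B \<gamma> \<beta> / B \<gamma> \<gamma> = 2 * B \<delta> \<beta> / B \<delta> \<delta>"
          using fun_cong[OF eq, of \<beta>] that by simp
        then show ?thesis
          using V JV that nz by (simp add: form_smult subset_iff c_def field_simps)
      qed
      \<comment> \<open>Equal coroots make the roots proportional, with the ratio of their norms as
        factor. Since scaling by c multiplies the norm by c squared, c = c * c.\<close>
      then have \<gamma>_eq: "\<gamma> = c \<odot>\<^bsub>V\<^esub> \<delta>"
        using V by (intro nondegenerate_eqI[OF nondeg JV J(3)]) auto
      have "B \<gamma> \<gamma> = c * c * B \<delta> \<delta>"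
        using V by (subst (1 2) \<gamma>_eq) (simp add: form_smult form_smult_right)
      then have "c = c * c"
        using nz by (simp add: c_def)
      then have "c = 1"
        using c by simp
      then show "\<gamma> = \<delta>"
        using \<gamma>_eq V module.smult_one[of \<delta>] by simp
    qed
    show "(\<lambda>\<gamma>. \<lambda>\<beta>\<in>J. 2 * B \<gamma> \<beta> / B \<gamma> \<gamma>) ` N \<subseteq> J \<rightarrow>\<^sub>E of_int ` {-2..2}"
    proof (intro image_subsetI PiE_I)
      fix \<gamma> \<beta> assume "\<gamma> \<in> N" "\<beta> \<in> J"
      then obtain n :: int where "n \<in> {-2..2}" "2 * B \<gamma> \<beta> = of_int n * B \<gamma> \<gamma>"
        using isotropic_cartan_integer[of \<beta> \<gamma>] J(2) by (auto simp: N_def I_def)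
      then show "(\<lambda>\<beta>\<in>J. 2 * B \<gamma> \<beta> / B \<gamma> \<gamma>) \<beta> \<in> of_int ` {-2..2}"
        using \<open>\<gamma> \<in> N\<close> \<open>\<beta> \<in> J\<close> by (auto simp: N_def)
    qed auto
    show "finite (J \<rightarrow>\<^sub>E (of_int ` {-2..2::int} :: complex set))"
      using J(1) by (intro finite_PiE) auto
  qed
  \<comment> \<open>For isotropic \<alpha> and \<beta>, a root \<beta> + s \<alpha> has norm 2 s
    (\<alpha>,\<beta>), so \<open>D\<close> contains every pairing of two isotropic roots. It is
    finite because \<open>N\<close> is.\<close>
  define D where "D = insert 0 ((\<lambda>(s, \<gamma>). of_int s * B \<gamma> \<gamma> / 2) ` ({-1..1::int} \<times> N))"
  have "finite I"
  proof (rule inj_on_finite)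
    show "inj_on (\<lambda>\<alpha>. \<lambda>\<beta>\<in>J. B \<alpha> \<beta>) I"
    proof (rule inj_onI)
      fix \<alpha> \<alpha>' assume "\<alpha> \<in> I" "\<alpha>' \<in> I" and eq: "(\<lambda>\<beta>\<in>J. B \<alpha> \<beta>) = (\<lambda>\<beta>\<in>J. B \<alpha>' \<beta>)"
      moreover have "B \<alpha> \<beta> = B \<alpha>' \<beta>" if "\<beta> \<in> J" for \<beta>
        using fun_cong[OF eq, of \<beta>] that by simp
      ultimately show "\<alpha> = \<alpha>'"
        using \<open>I \<subseteq> carrier V\<close> by (intro nondegenerate_eqI[OF nondeg JV J(3)]) auto
    qed
    show "(\<lambda>\<alpha>. \<lambda>\<beta>\<in>J. B \<alpha> \<beta>) ` I \<subseteq> J \<rightarrow>\<^sub>E D"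
    proof (intro image_subsetI PiE_I)
      fix \<alpha> \<beta> assume "\<alpha> \<in> I" "\<beta> \<in> J"
      then have \<alpha>: "\<alpha> \<in> R" "B \<alpha> \<alpha> = 0" and \<beta>: "\<beta> \<in> R" "B \<beta> \<beta> = 0"
        using J(2) by (auto simp: I_def)
      have "B \<alpha> \<beta> \<in> D"
      proof (cases "B \<alpha> \<beta> = 0")
        case False
        then obtain s \<delta> where s: "s = 1 \<or> s = - 1" and \<delta>: "\<delta> \<in> R"
          "\<And>w. w \<in> carrier V \<Longrightarrow> B \<delta> w = B \<beta> w + of_int s * B \<alpha> w"
          using isotropic_step[OF \<alpha> \<beta>(1)] by metis
        have "B \<delta> \<alpha> = B \<alpha> \<beta>" "B \<delta> \<beta> = of_int s * B \<alpha> \<beta>"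
          using \<delta>(2)[of \<alpha>] \<delta>(2)[of \<beta>] \<alpha> \<beta> root_sym[of \<alpha> \<beta>] by simp_all
        then have norm: "B \<delta> \<delta> = 2 * of_int s * B \<alpha> \<beta>"
          using \<delta>(2)[of \<delta>] \<delta>(1) root_sym[of \<delta> \<alpha>] root_sym[of \<delta> \<beta>] \<alpha> \<beta> by simp
        then have "\<delta> \<in> N"
          using False s \<delta>(1) by (auto simp: N_def)
        moreover have "B \<alpha> \<beta> = of_int s * B \<delta> \<delta> / 2"
          using norm s by auto
        ultimately show ?thesis
          using s unfolding D_def by (intro insertI2 image_eqI[of _ _ "(s, \<delta>)"]) auto
      qed (simp add: D_def)
      then show "(\<lambda>\<beta>\<in>J. B \<alpha> \<beta>) \<beta> \<in> D"
        using \<open>\<beta> \<in> J\<close> by simp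
    qed auto
    show "finite (J \<rightarrow>\<^sub>E D)"
      using J(1) \<open>finite N\<close> by (intro finite_PiE) (auto simp: D_def)
  qed
  moreover have "R = I \<union> N"
    by (auto simp: I_def N_def)
  ultimately show ?thesis
    using \<open>finite N\<close> by simp
qed

end


section \<open>The canonical map\<close>

context complex_form_space
begin

abbreviation formal_sums :: "'v set \<Rightarrow> ('v \<times> complex \<Rightarrow>\<^sub>0 int) monoid" where
  "formal_sums S \<equiv> free_Abelian_group (int_span V S \<times> UNIV)"

text \<open>The complexification is the quotient of \<open>formal_sums S\<close> by this subgroup,
  so computing there amounts to computing with formal sums up to membership here.\<close>

definition null_sums :: "'v set \<Rightarrow> ('v \<times> complex \<Rightarrow>\<^sub>0 int) set" where
  "null_sums S = generate (formal_sums S)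
     (tensor_relations ((add_monoid V)\<lparr>carrier := int_span V S\<rparr>) (add_monoid (class_ring :: complex ring)))"

lemma add_pow_smult:
  fixes k :: int
  assumes v: "v \<in> carrier V"
  shows "[k] \<cdot>\<^bsub>V\<^esub> v = of_int k \<odot>\<^bsub>V\<^esub> v"
proof -
  have nat: "[n] \<cdot>\<^bsub>V\<^esub> v = of_nat n \<odot>\<^bsub>V\<^esub> v" for n :: nat
  proof (induction n)
    case (Suc n)
    then show ?case
      using v module.smult_l_distr[of "of_nat n" 1 v] module.smult_one[of v]
      by (simp add: add_pow_def nat_pow_def add.commute[of 1])
  qed (use v in \<open>simp add: add_pow_def nat_pow_def lmult_0[simplified]\<close>)
  show ?thesis
  proof (cases "k \<ge> 0")
    case True
    then show ?thesis
      by (simp add: add_pow_int_ge nat)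
  next
    case False
    then show ?thesis
      using v module.smult_l_minus[of "of_int (- k)" v]
      by (simp add: add_pow_int_lt nat class_ring_simps)
  qed
qed

section \<open>Closure properties of the integer span\<close>

lemma int_span_subgroup:
  assumes "S \<subseteq> carrier V"
  shows "subgroup (int_span V S) (add_monoid V)"
  unfolding int_span_def using assms
  by (intro group.generate_is_subgroup module.M.a_group) simp

lemma int_span_closed:
  assumes "S \<subseteq> carrier V" "v \<in> int_span V S"
  shows "v \<in> carrier V"
  using subgroup.mem_carrier[OF int_span_subgroup[OF assms(1)] assms(2)] by simp

lemma int_span_zero: "S \<subseteq> carrier V \<Longrightarrow> \<zero>\<^bsub>V\<^esub> \<in> int_span V S"
  using subgroup.one_closed[OF int_span_subgroup] by simp

lemma int_span_add:
  "\<lbrakk>S \<subseteq> carrier V; u \<in> int_span V S; v \<in> int_span V S\<rbrakk> \<Longrightarrow> u \<oplus>\<^bsub>V\<^esub> v \<in> int_span V S"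
  using subgroup.m_closed[OF int_span_subgroup] by simp

lemma int_span_uminus: "\<lbrakk>S \<subseteq> carrier V; v \<in> int_span V S\<rbrakk> \<Longrightarrow> \<ominus>\<^bsub>V\<^esub> v \<in> int_span V S"
  using subgroup.m_inv_closed[OF int_span_subgroup] by (simp add: a_inv_def)

lemma int_span_smult:
  assumes S: "S \<subseteq> carrier V" and v: "v \<in> int_span V S"
  shows "of_int k \<odot>\<^bsub>V\<^esub> v \<in> int_span V S"
proof -
  have vV: "v \<in> carrier V"
    by (rule int_span_closed[OF S v])
  have nat: "of_nat n \<odot>\<^bsub>V\<^esub> v \<in> int_span V S" for n
  proof (induction n)
    case (Suc n)
    then show ?case
      using vV v S module.smult_l_distr[of "of_nat n" 1 v] module.smult_one[of v]
      by (simp add: int_span_add add.commute[of 1])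
  qed (use vV S in \<open>simp add: lmult_0[simplified] int_span_zero\<close>)
  show ?thesis
  proof (cases "k \<ge> 0")
    case True
    then show ?thesis
      using nat[of "nat k"] by simp
  next
    case False
    then have "of_int k \<odot>\<^bsub>V\<^esub> v = \<ominus>\<^bsub>V\<^esub> (of_nat (nat (- k)) \<odot>\<^bsub>V\<^esub> v)"
      using vV module.smult_l_minus[of "of_nat (nat (- k))" v] by (simp add: class_ring_simps)
    then show ?thesis
      using nat[of "nat (- k)"] S by (simp add: int_span_uminus)
  qed
qed

lemma int_span_finsum:
  assumes S: "S \<subseteq> carrier V" and "finite A" "f \<in> A \<rightarrow> int_span V S"
  shows "finsum V f A \<in> int_span V S"
  using assms(2,3)
proof (induction A rule: finite_induct)
  case (insert a A)
  then have "f \<in> insert a A \<rightarrow> carrier V"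
    using int_span_closed[OF S] by auto
  then show ?case
    using insert by (simp add: int_span_add[OF S] Pi_def)
qed (simp add: int_span_zero[OF S])

text \<open>Keys may cancel in a sum, so the evaluations of \<open>x\<close>, \<open>y\<close> and
  \<open>x + y\<close> can only be compared over a common index set; indices outside the keys
  contribute 0.\<close>

lemma formal_evaluation_superset:
  assumes S: "S \<subseteq> carrier V" and x: "Poly_Mapping.keys x \<subseteq> int_span V S \<times> UNIV"
    and K: "finite K" "Poly_Mapping.keys x \<subseteq> K" "K \<subseteq> int_span V S \<times> UNIV"
  shows "formal_evaluation V x =
    (\<Oplus>\<^bsub>V\<^esub>p\<in>K. (of_int (Poly_Mapping.lookup x p) * snd p) \<odot>\<^bsub>V\<^esub> fst p)"
proof -
  have V: "fst p \<in> carrier V" if "p \<in> K" for p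
    using that K int_span_closed[OF S] by (auto simp: mem_Times_iff)
  have "formal_evaluation V x =
    (\<Oplus>\<^bsub>V\<^esub>p\<in>Poly_Mapping.keys x. (of_int (Poly_Mapping.lookup x p) * snd p) \<odot>\<^bsub>V\<^esub> fst p)"
    unfolding formal_evaluation_def
  proof (rule module.M.finsum_cong'[OF refl])
    fix p assume "p \<in> Poly_Mapping.keys x"
    then have "fst p \<in> carrier V"
      using V K(2) by blast
    then show "[Poly_Mapping.lookup x p] \<cdot>\<^bsub>V\<^esub> (snd p \<odot>\<^bsub>V\<^esub> fst p) =
        (of_int (Poly_Mapping.lookup x p) * snd p) \<odot>\<^bsub>V\<^esub> fst p"
      by (simp add: add_pow_smult module.smult_assoc1[simplified])
  qed (rule Pi_I, simp add: V[OF subsetD[OF K(2)]])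
  also have "\<dots> = (\<Oplus>\<^bsub>V\<^esub>p\<in>K. (of_int (Poly_Mapping.lookup x p) * snd p) \<odot>\<^bsub>V\<^esub> fst p)"
    using V K by (intro module.M.add.finprod_mono_neutral_cong_left)
      (auto simp: in_keys_iff lmult_0[simplified] subset_iff)
  finally show ?thesis .
qed

lemma formal_evaluation_closed:
  assumes S: "S \<subseteq> carrier V" and x: "Poly_Mapping.keys x \<subseteq> int_span V S \<times> UNIV"
  shows "formal_evaluation V x \<in> carrier V"
  using int_span_closed[OF S] x
  by (subst formal_evaluation_superset[OF S x finite_keys]) (auto intro!: module.M.finsum_closed simp: subset_iff mem_Times_iff)

lemma formal_evaluation_add:
  assumes S: "S \<subseteq> carrier V" and x: "Poly_Mapping.keys x \<subseteq> int_span V S \<times> UNIV"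
    and y: "Poly_Mapping.keys y \<subseteq> int_span V S \<times> UNIV"
  shows "formal_evaluation V (x + y) = formal_evaluation V x \<oplus>\<^bsub>V\<^esub> formal_evaluation V y"
proof -
  define K where "K = Poly_Mapping.keys x \<union> Poly_Mapping.keys y"
  have K: "finite K" "K \<subseteq> int_span V S \<times> UNIV" "Poly_Mapping.keys x \<subseteq> K" "Poly_Mapping.keys y \<subseteq> K"
    "Poly_Mapping.keys (x + y) \<subseteq> K"
    using x y keys_add[of x y] by (auto simp: K_def)
  have V: "fst p \<in> carrier V" if "p \<in> K" for p
    using that K int_span_closed[OF S] by (auto simp: mem_Times_iff)
  have "formal_evaluation V (x + y) =
    (\<Oplus>\<^bsub>V\<^esub>p\<in>K. (of_int (Poly_Mapping.lookup (x + y) p) * snd p) \<odot>\<^bsub>V\<^esub> fst p)"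
    using K by (intro formal_evaluation_superset[OF S]) auto
  also have "\<dots> = (\<Oplus>\<^bsub>V\<^esub>p\<in>K. (of_int (Poly_Mapping.lookup x p) * snd p) \<odot>\<^bsub>V\<^esub> fst p \<oplus>\<^bsub>V\<^esub>
      (of_int (Poly_Mapping.lookup y p) * snd p) \<odot>\<^bsub>V\<^esub> fst p)"
    using V by (intro module.M.finsum_cong')
      (auto simp: lookup_add distrib_right module.smult_l_distr[simplified])
  also have "\<dots> = (\<Oplus>\<^bsub>V\<^esub>p\<in>K. (of_int (Poly_Mapping.lookup x p) * snd p) \<odot>\<^bsub>V\<^esub> fst p) \<oplus>\<^bsub>V\<^esub>
      (\<Oplus>\<^bsub>V\<^esub>p\<in>K. (of_int (Poly_Mapping.lookup y p) * snd p) \<odot>\<^bsub>V\<^esub> fst p)"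
    using V by (intro module.M.finsum_addf) auto
  also have "\<dots> = formal_evaluation V x \<oplus>\<^bsub>V\<^esub> formal_evaluation V y"
    using K x y by (simp add: formal_evaluation_superset[OF S, of _ K])
  finally show ?thesis .
qed

lemma formal_evaluation_uminus:
  assumes S: "S \<subseteq> carrier V" and x: "Poly_Mapping.keys x \<subseteq> int_span V S \<times> UNIV"
  shows "formal_evaluation V (- x) = \<ominus>\<^bsub>V\<^esub> formal_evaluation V x"
proof -
  have "formal_evaluation V (- x) \<oplus>\<^bsub>V\<^esub> formal_evaluation V x = formal_evaluation V (- x + x)"
    using x by (intro formal_evaluation_add[OF S, symmetric]) auto
  also have "\<dots> = \<zero>\<^bsub>V\<^esub>"
    by (simp add: formal_evaluation_def)
  finally show ?thesis
    using formal_evaluation_closed[OF S] x by (intro module.M.minus_equality[symmetric]) auto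
qed

lemma formal_evaluation_diff:
  assumes S: "S \<subseteq> carrier V" and x: "Poly_Mapping.keys x \<subseteq> int_span V S \<times> UNIV"
    and y: "Poly_Mapping.keys y \<subseteq> int_span V S \<times> UNIV"
  shows "formal_evaluation V (x - y) = formal_evaluation V x \<ominus>\<^bsub>V\<^esub> formal_evaluation V y"
  using formal_evaluation_add[OF S x, of "- y"] formal_evaluation_uminus[OF S y] y
  by (simp add: a_minus_def)

lemma formal_evaluation_frag_of:
  assumes "v \<in> carrier V"
  shows "formal_evaluation V (frag_of (v, c)) = c \<odot>\<^bsub>V\<^esub> v"
proof -
  have "c \<odot>\<^bsub>V\<^esub> v \<in> carrier V"
    using assms by simp
  then show ?thesis
    by (simp add: formal_evaluation_def add_pow_smult module.smult_one[simplified])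
qed

section \<open>The subgroup of null sums and evaluation on its cosets\<close>

lemma relations_subset:
  assumes "S \<subseteq> carrier V"
  shows "tensor_relations ((add_monoid V)\<lparr>carrier := int_span V S\<rparr>) (add_monoid (class_ring :: complex ring))
    \<subseteq> carrier (formal_sums S)"
  using int_span_add[OF assms]
  by (auto simp: tensor_relations_def dest!: subsetD[OF keys_diff])

lemma null_sums_subgroup:
  assumes "S \<subseteq> carrier V"
  shows "subgroup (null_sums S) (formal_sums S)"
  unfolding null_sums_def
  by (intro group.generate_is_subgroup relations_subset assms group_free_Abelian_group)

lemma null_sums_keys:
  assumes "S \<subseteq> carrier V" "x \<in> null_sums S"
  shows "Poly_Mapping.keys x \<subseteq> int_span V S \<times> UNIV"
  using subgroup.mem_carrier[OF null_sums_subgroup[OF assms(1)] assms(2)] by simp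

lemma null_sums_add: "\<lbrakk>S \<subseteq> carrier V; x \<in> null_sums S; y \<in> null_sums S\<rbrakk> \<Longrightarrow> x + y \<in> null_sums S"
  using subgroup.m_closed[OF null_sums_subgroup] by simp

lemma null_sums_zero: "S \<subseteq> carrier V \<Longrightarrow> 0 \<in> null_sums S"
  using subgroup.one_closed[OF null_sums_subgroup] by simp

lemma null_sums_uminus: "\<lbrakk>S \<subseteq> carrier V; x \<in> null_sums S\<rbrakk> \<Longrightarrow> - x \<in> null_sums S"
  using subgroup.m_inv_closed[OF null_sums_subgroup] null_sums_keys by simp

lemma null_sums_diff: "\<lbrakk>S \<subseteq> carrier V; x \<in> null_sums S; y \<in> null_sums S\<rbrakk> \<Longrightarrow> x - y \<in> null_sums S"
  using null_sums_add[of S x "- y"] null_sums_uminus[of S y] by simp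

lemma null_sums_sum:
  assumes S: "S \<subseteq> carrier V" and "\<And>i. i \<in> I \<Longrightarrow> f i \<in> null_sums S"
  shows "sum f I \<in> null_sums S"
  using assms(2)
  by (induction I rule: infinite_finite_induct) (auto simp: null_sums_zero[OF S] null_sums_add[OF S])

lemma formal_evaluation_relation:
  assumes S: "S \<subseteq> carrier V"
    and h: "h \<in> tensor_relations ((add_monoid V)\<lparr>carrier := int_span V S\<rparr>) (add_monoid (class_ring :: complex ring))"
  shows "formal_evaluation V h = \<zero>\<^bsub>V\<^esub>"
proof -
  \<comment> \<open>Both families of tensor relations have this shape, with either the vectors or
    the scalars being added.\<close>
  have rel: "formal_evaluation V h = \<zero>\<^bsub>V\<^esub>"
    if h: "h = frag_of (w, a) - frag_of (u, b) - frag_of (v, c)" and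
      uvw: "u \<in> int_span V S" "v \<in> int_span V S" "w \<in> int_span V S"
      and eq: "a \<odot>\<^bsub>V\<^esub> w = b \<odot>\<^bsub>V\<^esub> u \<oplus>\<^bsub>V\<^esub> c \<odot>\<^bsub>V\<^esub> v" for u v w a b c
  proof -
    have V: "u \<in> carrier V" "v \<in> carrier V" "w \<in> carrier V"
      using uvw int_span_closed[OF S] by auto
    have "Poly_Mapping.keys (frag_of (w, a) - frag_of (u, b)) \<subseteq> int_span V S \<times> UNIV"
      using uvw keys_diff[of "frag_of (w, a)" "frag_of (u, b)"] by auto
    then have "formal_evaluation V h = a \<odot>\<^bsub>V\<^esub> w \<ominus>\<^bsub>V\<^esub> b \<odot>\<^bsub>V\<^esub> u \<ominus>\<^bsub>V\<^esub> c \<odot>\<^bsub>V\<^esub> v"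
      using uvw V by (simp add: h formal_evaluation_diff[OF S] formal_evaluation_frag_of)
    also have "\<dots> = a \<odot>\<^bsub>V\<^esub> w \<ominus>\<^bsub>V\<^esub> (b \<odot>\<^bsub>V\<^esub> u \<oplus>\<^bsub>V\<^esub> c \<odot>\<^bsub>V\<^esub> v)"
      using V by (simp add: a_minus_def module.M.minus_add module.M.a_assoc)
    also have "\<dots> = \<zero>\<^bsub>V\<^esub>"
      using V by (simp add: eq a_minus_def module.M.r_neg)
    finally show ?thesis .
  qed
  show ?thesis
    using h unfolding tensor_relations_def
  proof (elim UnE CollectE exE conjE, goal_cases)
    case (1 x y c)
    then show ?case
      using int_span_closed[OF S]
      by (intro rel[of "x \<oplus>\<^bsub>V\<^esub> y" c x c y c]) (auto simp: int_span_add[OF S] module.smult_r_distr[simplified])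
  next
    case (2 x c d)
    then show ?case
      using int_span_closed[OF S]
      by (intro rel[of x "c + d" x c x d]) (auto simp: module.smult_l_distr[simplified])
  qed
qed

lemma formal_evaluation_null_sums:
  assumes S: "S \<subseteq> carrier V" and "x \<in> null_sums S"
  shows "formal_evaluation V x = \<zero>\<^bsub>V\<^esub>"
  using assms(2) unfolding null_sums_def
proof (induction x rule: generate.induct)
  case (inv h)
  have "h \<in> null_sums S"
    unfolding null_sums_def by (rule generate.incl[OF inv])
  then show ?case
    using null_sums_keys[OF S] formal_evaluation_relation[OF S inv]
    by (simp add: formal_evaluation_uminus[OF S])
next
  case (eng h1 h2)
  then have "h1 \<in> null_sums S" "h2 \<in> null_sums S"
    by (simp_all only: null_sums_def)
  then show ?case
    using null_sums_keys[OF S] eng.IH by (simp add: formal_evaluation_add[OF S])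
qed (simp_all add: formal_evaluation_def[of _ 0] formal_evaluation_relation[OF S])

text \<open>Evaluation kills null sums and is therefore constant on each coset. The image in the
  definition of \<open>canonical_map\<close> is thus a singleton, as \<open>the_elem\<close>
  requires.\<close>

lemma formal_evaluation_coset:
  assumes S: "S \<subseteq> carrier V" and x: "x \<in> carrier (formal_sums S)"
  shows "canonical_map V (null_sums S #>\<^bsub>formal_sums S\<^esub> x) = formal_evaluation V x"
proof -
  have "formal_evaluation V (t + x) = formal_evaluation V x" if "t \<in> null_sums S" for t
    using that x formal_evaluation_closed[OF S, of x] null_sums_keys[OF S that]
    by (simp add: formal_evaluation_add[OF S] formal_evaluation_null_sums[OF S])
  then have "formal_evaluation V ` (null_sums S #>\<^bsub>formal_sums S\<^esub> x) = {formal_evaluation V x}"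
    using null_sums_zero[OF S] by (force simp: r_coset_def)
  then show ?thesis
    by (simp add: canonical_map_def)
qed

section \<open>Surjectivity and bijectivity of the canonical map\<close>

lemma carrier_complexification:
  "carrier (complexification V S) = (\<lambda>x. null_sums S #>\<^bsub>formal_sums S\<^esub> x) ` carrier (formal_sums S)"
  by (auto simp: complexification_def tensor_product_def FactGroup_def RCOSETS_def null_sums_def Let_def)

text \<open>This translates surjectivity of the canonical map into linear spanning and back. A
  linear combination is the value of the formal sum with the same terms; conversely, each term of an
  evaluation is a multiple of an element of the integer span, which lies in
  \<open>span S\<close>.\<close>

lemma span_eq_formal_evaluation:
  assumes S: "S \<subseteq> carrier V"
  shows "span S = formal_evaluation V ` carrier (formal_sums S)"
proof (intro equalityI subsetI)
  fix v assume "v \<in> span S"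
  then obtain a A where A: "finite A" "A \<subseteq> S" "v = lincomb a A"
    unfolding span_def by blast
  have "\<exists>x\<in>carrier (formal_sums S). formal_evaluation V x = lincomb a A"
    using A(1,2) unfolding lincomb_def
  proof (induction A rule: finite_induct)
    case empty
    show ?case
      by (rule bexI[of _ 0]) (simp_all add: formal_evaluation_def)
  next
    case (insert b A)
    then obtain x where x: "Poly_Mapping.keys x \<subseteq> int_span V S \<times> UNIV"
      "formal_evaluation V x = (\<Oplus>\<^bsub>V\<^esub>v\<in>A. a v \<odot>\<^bsub>V\<^esub> v)"
      by auto
    have b: "b \<in> int_span V S"
      using insert.prems by (auto simp: int_span_def intro: generate.incl)
    have V: "insert b A \<subseteq> carrier V"
      using insert.prems S by (rule subset_trans)
    have keys: "Poly_Mapping.keys (frag_of (b, a b)) \<subseteq> int_span V S \<times> UNIV"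
      using b by simp
    have "formal_evaluation V (frag_of (b, a b) + x) = a b \<odot>\<^bsub>V\<^esub> b \<oplus>\<^bsub>V\<^esub> (\<Oplus>\<^bsub>V\<^esub>v\<in>A. a v \<odot>\<^bsub>V\<^esub> v)"
      unfolding formal_evaluation_add[OF S keys x(1)] x(2) using V by (simp add: formal_evaluation_frag_of)
    also have "\<dots> = (\<Oplus>\<^bsub>V\<^esub>v\<in>insert b A. a v \<odot>\<^bsub>V\<^esub> v)"
      using V insert.hyps by (intro module.M.finsum_insert[symmetric]) (auto simp: subset_iff)
    finally show ?case
      using keys x(1) keys_add[of "frag_of (b, a b)" x]
      by (intro bexI[of _ "frag_of (b, a b) + x"]) auto
  qed
  then show "v \<in> formal_evaluation V ` carrier (formal_sums S)"
    using A(3) by force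
next
  have sub: "LinearCombinations.submodule class_ring (span S) V"
    by (rule span_is_submodule[OF S])
  have "u \<in> span S" if "u \<in> int_span V S" for u
    using that unfolding int_span_def
  proof (induction u rule: generate.induct)
    case one
    then show ?case
      using LinearCombinations.submodule.zero_closed[OF sub] by simp
  next
    case (incl h)
    then show ?case
      by (rule subsetD[OF in_own_span[OF S]])
  next
    case (inv h)
    then have "(- 1) \<odot>\<^bsub>V\<^esub> h \<in> span S"
      using LinearCombinations.submodule.smult_closed[OF sub, of "- 1"] subsetD[OF in_own_span[OF S]] by simp
    moreover have "(- 1) \<odot>\<^bsub>V\<^esub> h = \<ominus>\<^bsub>V\<^esub> h"
      using subsetD[OF S inv] module.smult_l_minus[of 1 h] module.smult_one[of h] by (simp add: class_ring_simps)
    ultimately show ?case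
      by (simp add: a_inv_def)
  next
    case (eng h1 h2)
    then show ?case
      using LinearCombinations.submodule.m_closed[OF sub] by simp
  qed
  note int = this
  fix v assume "v \<in> formal_evaluation V ` carrier (formal_sums S)"
  then obtain x where x: "Poly_Mapping.keys x \<subseteq> int_span V S \<times> UNIV" "v = formal_evaluation V x"
    by auto
  have "(\<Oplus>\<^bsub>V\<^esub>p\<in>K. (of_int (Poly_Mapping.lookup x p) * snd p) \<odot>\<^bsub>V\<^esub> fst p) \<in> span S"
    if "finite K" "K \<subseteq> int_span V S \<times> UNIV" for K
    using that
  proof (induction K rule: finite_induct)
    case empty
    then show ?case
      using LinearCombinations.submodule.zero_closed[OF sub] by simp
  next
    case (insert p K)
    have closed: "(of_int (Poly_Mapping.lookup x q) * snd q) \<odot>\<^bsub>V\<^esub> fst q \<in> span S" if "q \<in> insert p K" for q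
      using insert.prems that int LinearCombinations.submodule.smult_closed[OF sub] by auto
    then have "(of_int (Poly_Mapping.lookup x q) * snd q) \<odot>\<^bsub>V\<^esub> fst q \<in> carrier V" if "q \<in> insert p K" for q
      using that span_is_subset2[OF S] by blast
    then have "(\<Oplus>\<^bsub>V\<^esub>q\<in>insert p K. (of_int (Poly_Mapping.lookup x q) * snd q) \<odot>\<^bsub>V\<^esub> fst q) =
      (of_int (Poly_Mapping.lookup x p) * snd p) \<odot>\<^bsub>V\<^esub> fst p \<oplus>\<^bsub>V\<^esub>
        (\<Oplus>\<^bsub>V\<^esub>q\<in>K. (of_int (Poly_Mapping.lookup x q) * snd q) \<odot>\<^bsub>V\<^esub> fst q)"
      using insert.hyps by (intro module.M.finsum_insert) auto
    then show ?case
      using closed[of p] insert LinearCombinations.submodule.m_closed[OF sub] by simp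
  qed
  then show "v \<in> span S"
    using formal_evaluation_superset[OF S x(1) finite_keys subset_refl x(1)] x by simp
qed

lemma span_of_canonical_map:
  assumes S: "S \<subseteq> carrier V"
    and surj: "canonical_map V ` carrier (complexification V S) = carrier V"
  shows "span S = carrier V"
proof -
  have "canonical_map V ` carrier (complexification V S) = formal_evaluation V ` carrier (formal_sums S)"
    unfolding carrier_complexification image_image
    using formal_evaluation_coset[OF S] by (intro image_cong) auto
  then show ?thesis
    using surj span_eq_formal_evaluation[OF S] by simp
qed

text \<open>Spanning gives surjectivity; injectivity follows by applying \<open>null\<close> to the
  difference of two representatives.\<close>

lemma canonical_map_bij_betw:
  assumes S: "S \<subseteq> carrier V" and span: "span S = carrier V"
    and null: "\<And>x. \<lbrakk>x \<in> carrier (formal_sums S); formal_evaluation V x = \<zero>\<^bsub>V\<^esub>\<rbrakk> \<Longrightarrow> x \<in> null_sums S"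
  shows "bij_betw (canonical_map V) (carrier (complexification V S)) (carrier V)"
  unfolding bij_betw_def
proof
  show "canonical_map V ` carrier (complexification V S) = carrier V"
    unfolding carrier_complexification image_image span[symmetric] span_eq_formal_evaluation[OF S]
    using formal_evaluation_coset[OF S] by (intro image_cong) auto
  show "inj_on (canonical_map V) (carrier (complexification V S))"
  proof (rule inj_onI)
    fix X Y assume "X \<in> carrier (complexification V S)" "Y \<in> carrier (complexification V S)"
      and eq: "canonical_map V X = canonical_map V Y"
    then obtain x y where x: "x \<in> carrier (formal_sums S)" "X = null_sums S #>\<^bsub>formal_sums S\<^esub> x"
      and y: "y \<in> carrier (formal_sums S)" "Y = null_sums S #>\<^bsub>formal_sums S\<^esub> y"
      unfolding carrier_complexification by blast
    have "formal_evaluation V x = formal_evaluation V y"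
      using eq x y formal_evaluation_coset[OF S] by simp
    then have "formal_evaluation V (x - y) = \<zero>\<^bsub>V\<^esub>"
      using x y formal_evaluation_closed[OF S, of y]
      by (simp add: formal_evaluation_diff[OF S] a_minus_def module.M.r_neg)
    then have "x - y \<in> null_sums S"
      using x y keys_diff[of x y] by (intro null) auto
    then have "x \<in> null_sums S #>\<^bsub>formal_sums S\<^esub> y"
      by (force simp: r_coset_def)
    then show "X = Y"
      using x y null_sums_subgroup[OF S] group.repr_independence[OF group_free_Abelian_group] by metis
  qed
qed

end


section \<open>Injectivity of the canonical map\<close>

text \<open>These are the coordinates in a basis of the complex numbers over the rationals. The
  second argument names the basis element; off the basis the coordinate is 0.\<close>

lemma rational_coordinates_complex:
  obtains coord :: "complex \<Rightarrow> complex \<Rightarrow> rat" where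
    "\<And>c. finite {b. coord c b \<noteq> 0}"
    "\<And>c. (\<Sum>b | coord c b \<noteq> 0. of_rat (coord c b) * b) = c"
    "\<And>c d b. coord (c + d) b = coord c b + coord d b"
    "\<And>q c b. coord (of_rat q * c) b = q * coord c b"
proof -
  interpret Q: Vector_Spaces.vector_space "\<lambda>(q :: rat) (c :: complex). of_rat q * c"
    by unfold_locales (auto simp: algebra_simps of_rat_add of_rat_mult)
  define H where "H = Q.extend_basis {}"
  have H: "Q.independent H" "Q.span H = UNIV"
    unfolding H_def
    by (rule Q.independent_extend_basis[OF Q.independent_empty] Q.span_extend_basis[OF Q.independent_empty])+
  show thesis
  proof (rule that[of "Q.representation H"])
    show "finite {b. Q.representation H c b \<noteq> 0}" for c
      by (rule Q.finite_representation)
    show "(\<Sum>b | Q.representation H c b \<noteq> 0. of_rat (Q.representation H c b) * b) = c" for c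
      by (rule Q.sum_nonzero_representation_eq) (simp_all add: H)
    show "Q.representation H (c + d) b = Q.representation H c b + Q.representation H d b" for c d b
      by (subst Q.representation_add) (simp_all add: H)
    show "Q.representation H (of_rat q * c) b = q * Q.representation H c b" for q c b
      by (subst Q.representation_scale) (simp_all add: H)
  qed
qed

text \<open>Denominators are cleared because integers, but not rationals, can be moved across the
  tensor sign onto an element of the integer span. The product of the denominators works.\<close>

lemma common_denominator:
  assumes "finite A"
  obtains D :: int where "D > 0" "\<And>q :: rat. q \<in> A \<Longrightarrow> \<exists>k :: int. of_int D * q = of_int k"
proof -
  have "\<exists>D :: int. D > 0 \<and> (\<forall>q\<in>A. \<exists>k :: int. of_int D * q = of_int k)"
    using assms
  proof (induction A rule: finite_induct)
    case empty
    show ?case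
      by (rule exI[of _ 1]) simp
  next
    case (insert q A)
    then obtain D :: int where D: "D > 0" "\<And>q. q \<in> A \<Longrightarrow> \<exists>k :: int. of_int D * q = of_int k"
      by blast
    obtain a b where q: "q = Rat.Fract a b" "b > 0"
      by (cases q) auto
    have "\<exists>k :: int. of_int (D * b) * r = of_int k" if r: "r \<in> insert q A" for r
    proof (cases "r = q")
      case True
      then have "of_int (D * b) * r = of_int (D * a)"
        using q by (simp add: Fract_of_int_quotient)
      then show ?thesis
        by blast
    next
      case False
      then obtain k :: int where "of_int D * r = of_int k"
        using D r by auto
      then have "of_int (D * b) * r = of_int (b * k)"
        by (simp add: mult_ac)
      then show ?thesis
        by blast
    qed
    moreover have "D * b > 0"
      using D q by simp
    ultimately show ?case
      by blast
  qed
  then show thesis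
    using that by blast
qed

context complex_form_space
begin

lemma form_finsum:
  assumes "u \<in> carrier V" "finite A" "f \<in> A \<rightarrow> carrier V"
  shows "B u (finsum V f A) = (\<Sum>a\<in>A. B u (f a))"
  using assms(2,3)
proof (induction A rule: finite_induct)
  case empty
  show ?case
    using assms(1) by (simp add: form_zero_right)
next
  case (insert a A)
  then show ?case
    using assms(1) by (simp add: form_add_right Pi_def)
qed

section \<open>Bilinear rules modulo null sums\<close>

lemma null_sums_add_left:
  assumes "u \<in> int_span V S" "v \<in> int_span V S"
  shows "frag_of (u \<oplus>\<^bsub>V\<^esub> v, c) - frag_of (u, c) - frag_of (v, c) \<in> null_sums S"
  unfolding null_sums_def tensor_relations_def using assms
  by (intro generate.incl UnI1) force

lemma null_sums_add_right:
  assumes "v \<in> int_span V S"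
  shows "frag_of (v, c + d) - frag_of (v, c) - frag_of (v, d) \<in> null_sums S"
  unfolding null_sums_def tensor_relations_def using assms
  by (intro generate.incl UnI2) force

text \<open>The additivity relation for 0 + 0 collapses to the negative of this generator.\<close>

lemma null_sums_zero_left:
  assumes S: "S \<subseteq> carrier V"
  shows "frag_of (\<zero>\<^bsub>V\<^esub>, c) \<in> null_sums S"
  using null_sums_uminus[OF S null_sums_add_left[OF int_span_zero[OF S] int_span_zero[OF S], of c]] by simp

lemma null_sums_zero_right:
  assumes S: "S \<subseteq> carrier V" and v: "v \<in> int_span V S"
  shows "frag_of (v, 0) \<in> null_sums S"
  using null_sums_uminus[OF S null_sums_add_right[OF v, of 0 0]] by simp

lemma null_sums_smult_left:
  assumes S: "S \<subseteq> carrier V" and v: "v \<in> int_span V S"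
  shows "frag_cmul k (frag_of (v, c)) - frag_of (of_int k \<odot>\<^bsub>V\<^esub> v, c) \<in> null_sums S"
proof -
  have vV: "v \<in> carrier V"
    by (rule int_span_closed[OF S v])
  \<comment> \<open>Being an equivalence, this serves the integer induction both upwards and
    downwards.\<close>
  have step: "frag_cmul (i + 1) (frag_of (v, c)) - frag_of (of_int (i + 1) \<odot>\<^bsub>V\<^esub> v, c) \<in> null_sums S
    \<longleftrightarrow> frag_cmul i (frag_of (v, c)) - frag_of (of_int i \<odot>\<^bsub>V\<^esub> v, c) \<in> null_sums S" (is "?l \<in> _ \<longleftrightarrow> ?r \<in> _") for i
  proof -
    have rel: "frag_of (of_int i \<odot>\<^bsub>V\<^esub> v \<oplus>\<^bsub>V\<^esub> v, c) - frag_of (of_int i \<odot>\<^bsub>V\<^esub> v, c) - frag_of (v, c) \<in> null_sums S"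
      using v int_span_smult[OF S v] by (intro null_sums_add_left)
    have "of_int (i + 1) \<odot>\<^bsub>V\<^esub> v = of_int i \<odot>\<^bsub>V\<^esub> v \<oplus>\<^bsub>V\<^esub> v"
      using vV module.smult_l_distr[of "of_int i" 1 v] module.smult_one[of v] by simp
    then have eq: "?r = ?l + (frag_of (of_int i \<odot>\<^bsub>V\<^esub> v \<oplus>\<^bsub>V\<^esub> v, c) - frag_of (of_int i \<odot>\<^bsub>V\<^esub> v, c) - frag_of (v, c))"
      by (simp add: frag_cmul_distrib)
    show ?thesis
      using null_sums_add[OF S _ rel, of ?l] null_sums_diff[OF S _ rel, of ?r] unfolding eq by auto
  qed
  show ?thesis
  proof (induction k rule: int_induct[where k = 0])
    case base
    have "0 \<odot>\<^bsub>V\<^esub> v = \<zero>\<^bsub>V\<^esub>"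
      using vV lmult_0 by simp
    then show ?case
      using null_sums_uminus[OF S null_sums_zero_left[OF S, of c]] by simp
  next
    case (step1 i)
    then show ?case
      using step by blast
  next
    case (step2 i)
    then show ?case
      using step[of "i - 1"] by simp
  qed
qed

lemma null_sums_smult_right:
  assumes S: "S \<subseteq> carrier V" and v: "v \<in> int_span V S"
  shows "frag_cmul k (frag_of (v, c)) - frag_of (v, of_int k * c) \<in> null_sums S"
proof -
  have step: "frag_cmul (i + 1) (frag_of (v, c)) - frag_of (v, of_int (i + 1) * c) \<in> null_sums S
    \<longleftrightarrow> frag_cmul i (frag_of (v, c)) - frag_of (v, of_int i * c) \<in> null_sums S" (is "?l \<in> _ \<longleftrightarrow> ?r \<in> _") for i
  proof -
    have rel: "frag_of (v, of_int i * c + c) - frag_of (v, of_int i * c) - frag_of (v, c) \<in> null_sums S"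
      using v by (rule null_sums_add_right)
    have "of_int (i + 1) * c = of_int i * c + c"
      by (simp add: algebra_simps)
    then have eq: "?r = ?l + (frag_of (v, of_int i * c + c) - frag_of (v, of_int i * c) - frag_of (v, c))"
      by (simp add: frag_cmul_distrib)
    show ?thesis
      using null_sums_add[OF S _ rel, of ?l] null_sums_diff[OF S _ rel, of ?r] unfolding eq by auto
  qed
  show ?thesis
  proof (induction k rule: int_induct[where k = 0])
    case base
    show ?case
      using null_sums_uminus[OF S null_sums_zero_right[OF S v]] by simp
  next
    case (step1 i)
    then show ?case
      using step by blast
  next
    case (step2 i)
    then show ?case
      using step[of "i - 1"] by simp
  qed
qed

lemma null_sums_finsum_left:
  assumes S: "S \<subseteq> carrier V" and "finite A" "f \<in> A \<rightarrow> int_span V S"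
  shows "(\<Sum>a\<in>A. frag_of (f a, c)) - frag_of (finsum V f A, c) \<in> null_sums S"
  using assms(2,3)
proof (induction A rule: finite_induct)
  case empty
  then show ?case
    using null_sums_uminus[OF S null_sums_zero_left[OF S, of c]] by simp
next
  case (insert a A)
  then have f: "f \<in> A \<rightarrow> int_span V S" "f a \<in> int_span V S"
    by auto
  then have "f \<in> A \<rightarrow> carrier V" "f a \<in> carrier V"
    using int_span_closed[OF S] by auto
  then have fs: "finsum V f (insert a A) = f a \<oplus>\<^bsub>V\<^esub> finsum V f A"
    using insert.hyps by simp
  have "frag_of (f a \<oplus>\<^bsub>V\<^esub> finsum V f A, c) - frag_of (f a, c) - frag_of (finsum V f A, c) \<in> null_sums S"
    using f insert.hyps by (intro null_sums_add_left int_span_finsum[OF S])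
  from null_sums_diff[OF S insert.IH[OF f(1)] this] show ?case
    unfolding fs using insert.hyps by (simp add: algebra_simps)
qed

lemma null_sums_sum_right:
  assumes S: "S \<subseteq> carrier V" and v: "v \<in> int_span V S" and "finite A"
  shows "frag_of (v, \<Sum>a\<in>A. f a) - (\<Sum>a\<in>A. frag_of (v, f a)) \<in> null_sums S"
  using assms(3)
proof (induction A rule: finite_induct)
  case empty
  then show ?case
    using null_sums_zero_right[OF S v] by simp
next
  case (insert a A)
  from null_sums_add[OF S insert.IH null_sums_add_right[OF v, of "f a" "sum f A"]] show ?case
    using insert.hyps by (simp add: algebra_simps)
qed

text \<open>If all scalars are integer combinations of common numbers \<open>e b\<close>, the
  integers can be moved onto the vectors. This leaves a single tensor for each \<open>b\<close>, so
  that a formal sum is null once each collected vector is 0.\<close>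

lemma null_sums_collect:
  assumes S: "S \<subseteq> carrier V" and K: "finite K" "K \<subseteq> int_span V S \<times> UNIV" and P: "finite P"
    and x: "x = (\<Sum>p\<in>K. frag_cmul (n p) (frag_of p))"
    and coeff: "\<And>p. p \<in> K \<Longrightarrow> snd p = (\<Sum>b\<in>P. of_int (k p b) * e b)"
  shows "x - (\<Sum>b\<in>P. frag_of (\<Oplus>\<^bsub>V\<^esub>p\<in>K. of_int (n p * k p b) \<odot>\<^bsub>V\<^esub> fst p, e b)) \<in> null_sums S"
proof -
  have v: "fst p \<in> int_span V S" if "p \<in> K" for p
    using that K by (auto simp: mem_Times_iff)
  have cmul_diff: "frag_cmul i (y - z) = frag_cmul i y - frag_cmul i z" for i and y z :: "('v \<times> complex) \<Rightarrow>\<^sub>0 int"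
    using frag_cmul_distrib2[of i "y - z" z] by simp
  \<comment> \<open>Containing 0 and being closed under differences suffices for integer
    multiples.\<close>
  have cmul: "frag_cmul i y \<in> null_sums S" if "y \<in> null_sums S" for i y
    using that null_sums_zero[OF S] null_sums_diff[OF S]
    by (intro frag_closure_minus_cmul[where P = "\<lambda>y. y \<in> null_sums S"])
  have "frag_cmul (n p) (frag_of p) - (\<Sum>b\<in>P. frag_of (of_int (n p * k p b) \<odot>\<^bsub>V\<^esub> fst p, e b)) \<in> null_sums S"
    if p: "p \<in> K" for p
  proof -
    \<comment> \<open>The scalar is first expanded along the \<open>e b\<close>, then the integers
      \<open>k p b\<close> are pulled out, and finally the products \<open>n p * k p b\<close> are
      pushed into the vector.\<close>
    have "frag_of p - (\<Sum>b\<in>P. frag_of (fst p, of_int (k p b) * e b)) \<in> null_sums S"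
      using null_sums_sum_right[OF S v[OF p] P] coeff[OF p] by (metis prod.collapse)
    then have 1: "frag_cmul (n p) (frag_of p - (\<Sum>b\<in>P. frag_of (fst p, of_int (k p b) * e b))) \<in> null_sums S"
      by (rule cmul)
    have "(\<Sum>b\<in>P. frag_cmul (n p) (frag_cmul (k p b) (frag_of (fst p, e b)) -
        frag_of (fst p, of_int (k p b) * e b))) \<in> null_sums S"
      using v[OF p] by (intro null_sums_sum[OF S] cmul null_sums_smult_right[OF S])
    from null_sums_diff[OF S 1 this]
    have 2: "frag_cmul (n p) (frag_of p) - (\<Sum>b\<in>P. frag_cmul (n p * k p b) (frag_of (fst p, e b))) \<in> null_sums S"
      by (simp add: cmul_diff frag_cmul_sum sum_subtractf)
    have "(\<Sum>b\<in>P. frag_cmul (n p * k p b) (frag_of (fst p, e b)) -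
        frag_of (of_int (n p * k p b) \<odot>\<^bsub>V\<^esub> fst p, e b)) \<in> null_sums S"
      using v[OF p] by (intro null_sums_sum[OF S] null_sums_smult_left[OF S])
    from null_sums_add[OF S 2 this] show ?thesis
      by (simp add: sum_subtractf)
  qed
  then have "(\<Sum>p\<in>K. frag_cmul (n p) (frag_of p) -
      (\<Sum>b\<in>P. frag_of (of_int (n p * k p b) \<odot>\<^bsub>V\<^esub> fst p, e b))) \<in> null_sums S"
    by (intro null_sums_sum[OF S])
  \<comment> \<open>Exchanging the summations groups the terms by \<open>b\<close>, so that their
    vectors can be added up.\<close>
  then have 3: "x - (\<Sum>b\<in>P. \<Sum>p\<in>K. frag_of (of_int (n p * k p b) \<odot>\<^bsub>V\<^esub> fst p, e b)) \<in> null_sums S"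
    by (simp add: x sum_subtractf sum.swap[of _ P K])
  have "(\<Sum>b\<in>P. (\<Sum>p\<in>K. frag_of (of_int (n p * k p b) \<odot>\<^bsub>V\<^esub> fst p, e b)) -
      frag_of (\<Oplus>\<^bsub>V\<^esub>p\<in>K. of_int (n p * k p b) \<odot>\<^bsub>V\<^esub> fst p, e b)) \<in> null_sums S"
    by (intro null_sums_sum[OF S] null_sums_finsum_left[OF S K(1)] Pi_I int_span_smult[OF S] v)
  from null_sums_add[OF S 3 this] show ?thesis
    by (simp add: sum_subtractf)
qed

end

section \<open>Formal sums with value 0 are null\<close>

context spanning_roots
begin

text \<open>The vectors in a formal sum lie in the integer span rather than in \<open>R\<close>; the
  factor found on the roots persists there.\<close>

lemma rational_multiple_int_span:
  assumes "\<alpha> \<in> R" "rational_multiple \<alpha>"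
  obtains c where "\<And>v. v \<in> int_span V R \<Longrightarrow> \<exists>q. B \<alpha> v = c * of_rat q"
proof -
  obtain c where c: "\<And>v. v \<in> R \<Longrightarrow> \<exists>q. B \<alpha> v = c * of_rat q"
    using assms(2) unfolding rational_multiple_def by (metis Rats_cases)
  have "\<exists>q. B \<alpha> v = c * of_rat q" if "v \<in> int_span V R" for v
    using that unfolding int_span_def
  proof (induction v rule: generate.induct)
    case one
    show ?case
      using assms by (intro exI[of _ 0]) (simp add: form_zero_right)
  next
    case (incl h)
    then show ?case
      by (rule c)
  next
    case (inv h)
    then obtain q where "B \<alpha> h = c * of_rat q"
      using c by blast
    then have "B \<alpha> (\<ominus>\<^bsub>V\<^esub> h) = c * of_rat (- q)"
      using inv assms form_uminus[of h \<alpha>] form_sym[of \<alpha> "\<ominus>\<^bsub>V\<^esub> h"] root_sym[of \<alpha> h]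
      by (simp add: of_rat_minus)
    then show ?case
      by (auto simp: a_inv_def)
  next
    case (eng h1 h2)
    then obtain q r where "B \<alpha> h1 = c * of_rat q" "B \<alpha> h2 = c * of_rat r"
      by blast
    moreover have "h1 \<in> carrier V" "h2 \<in> carrier V"
      using eng int_span_closed[OF roots_subset] by (simp_all add: int_span_def)
    ultimately have "B \<alpha> (h1 \<oplus>\<^bsub>V\<^esub> h2) = c * of_rat (q + r)"
      using assms by (simp add: form_add_right of_rat_add algebra_simps)
    then show ?case
      by auto
  qed
  then show thesis
    by (rule that)
qed

text \<open>Modulo null sums, \<open>x\<close> is a sum of tensors of vectors u_b with b / D, one
  for each basis number b that occurs. If (\<alpha>,-) is a nonzero multiple of a rational
  functional, pairing the value 0 with \<alpha> gives a relation between the scalars with rational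
  weights, and its b-coordinate is (\<alpha>,u_b) up to a factor. So u_b is orthogonal to such
  roots, then to all roots, and is 0 by nondegeneracy.\<close>

lemma null_sumsI:
  assumes nondeg: "nondegenerate V B"
    and x: "x \<in> carrier (formal_sums R)" and eval: "formal_evaluation V x = \<zero>\<^bsub>V\<^esub>"
  shows "x \<in> null_sums R"
proof -
  obtain coord :: "complex \<Rightarrow> complex \<Rightarrow> rat" where
    fin: "\<And>c. finite {b. coord c b \<noteq> 0}" and
    repr: "\<And>c. (\<Sum>b | coord c b \<noteq> 0. of_rat (coord c b) * b) = c" and
    coord_add: "\<And>c d b. coord (c + d) b = coord c b + coord d b" and
    coord_scale: "\<And>q c b. coord (of_rat q * c) b = q * coord c b"
    by (rule rational_coordinates_complex) (rule that; assumption)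
  have coord_sum: "coord (\<Sum>i\<in>A. of_rat (q i) * f i) b = (\<Sum>i\<in>A. q i * coord (f i) b)"
    if "finite A" for A :: "('v \<times> complex) set" and q f b
    \<comment> \<open>This instance says that all coordinates of 0 vanish, which settles the empty
      sum.\<close>
    using that coord_scale[of 0 0 b]
    by (induction A rule: finite_induct) (simp_all add: coord_add coord_scale)
  define K where "K = Poly_Mapping.keys x"
  define n where "n = Poly_Mapping.lookup x"
  have K: "finite K" "K \<subseteq> int_span V R \<times> UNIV"
    using x by (simp_all add: K_def)
  have v: "fst p \<in> int_span V R" "fst p \<in> carrier V" if "p \<in> K" for p
    using that K int_span_closed[OF roots_subset] by (auto simp: mem_Times_iff)
  define P where "P = (\<Union>p\<in>K. {b. coord (snd p) b \<noteq> 0})"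
  have P: "finite P"
    using K fin by (simp add: P_def)
  obtain D :: int where D: "D > 0"
    "\<And>q. q \<in> (\<lambda>(p, b). coord (snd p) b) ` (K \<times> P) \<Longrightarrow> \<exists>k :: int. of_int D * q = of_int k"
    using common_denominator[of "(\<lambda>(p, b). coord (snd p) b) ` (K \<times> P)"] K(1) P by auto
  \<comment> \<open>The floor merely names an integer: by the choice of \<open>D\<close> its
    argument is integral for \<open>p\<close> in \<open>K\<close> and \<open>b\<close> in
    \<open>P\<close>.\<close>
  define k where "k p b = \<lfloor>of_int D * coord (snd p) b\<rfloor>" for p :: "'v \<times> complex" and b
  have k: "of_int (k p b) = of_int D * coord (snd p) b" if "p \<in> K" "b \<in> P" for p b
    using D(2)[of "coord (snd p) b"] that by (force simp: k_def)
  \<comment> \<open>Dividing the basis numbers by \<open>D\<close> compensates for the factor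
    \<open>D\<close> in \<open>k\<close>.\<close>
  have coeff: "snd p = (\<Sum>b\<in>P. of_int (k p b) * (b / of_int D))" if p: "p \<in> K" for p
  proof -
    have "(\<Sum>b\<in>P. of_int (k p b) * (b / of_int D)) = (\<Sum>b\<in>P. of_rat (coord (snd p) b) * b)"
    proof (rule sum.cong[OF refl])
      fix b assume "b \<in> P"
      have "(of_int (k p b) :: complex) = of_rat (of_int D * coord (snd p) b)"
        using k[OF p \<open>b \<in> P\<close>] by (metis of_rat_of_int_eq)
      then show "of_int (k p b) * (b / of_int D) = of_rat (coord (snd p) b) * b"
        using D(1) by (simp add: of_rat_mult)
    qed
    also have "\<dots> = (\<Sum>b | coord (snd p) b \<noteq> 0. of_rat (coord (snd p) b) * b)"
      using p P by (intro sum.mono_neutral_right) (auto simp: P_def)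
    finally show ?thesis
      by (simp add: repr)
  qed
  have "x = (\<Sum>p\<in>K. frag_cmul (n p) (frag_of p))"
    using frag_expansion[of x] by (simp add: frag_extend_def K_def n_def)
  from null_sums_collect[OF roots_subset K P this coeff]
  have collected: "x - (\<Sum>b\<in>P. frag_of (\<Oplus>\<^bsub>V\<^esub>p\<in>K. of_int (n p * k p b) \<odot>\<^bsub>V\<^esub> fst p, b / of_int D)) \<in> null_sums R" .
  have form_eval: "(\<Sum>p\<in>K. of_int (n p) * snd p * B \<alpha> (fst p)) = 0" if "\<alpha> \<in> R" for \<alpha>
  proof -
    have "B \<alpha> (formal_evaluation V x) = (\<Sum>p\<in>K. B \<alpha> ((of_int (n p) * snd p) \<odot>\<^bsub>V\<^esub> fst p))"
      using K v that
      by (subst formal_evaluation_superset[OF roots_subset _ K(1)])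
        (auto simp: K_def[symmetric] n_def[symmetric] intro!: form_finsum)
    also have "\<dots> = (\<Sum>p\<in>K. of_int (n p) * snd p * B \<alpha> (fst p))"
      using v that by (intro sum.cong refl) (simp add: form_smult_right)
    finally show ?thesis
      using that by (simp add: eval form_zero_right)
  qed
  have "(\<Oplus>\<^bsub>V\<^esub>p\<in>K. of_int (n p * k p b) \<odot>\<^bsub>V\<^esub> fst p) = \<zero>\<^bsub>V\<^esub>" if b: "b \<in> P" for b
  proof -
    define u where "u = (\<Oplus>\<^bsub>V\<^esub>p\<in>K. of_int (n p * k p b) \<odot>\<^bsub>V\<^esub> fst p)"
    have u: "u \<in> carrier V"
      using v unfolding u_def by (intro module.M.finsum_closed) auto
    have form_u: "B \<alpha> u = (\<Sum>p\<in>K. of_int (n p * k p b) * B \<alpha> (fst p))" if "\<alpha> \<in> R" for \<alpha>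
    proof -
      have "B \<alpha> u = (\<Sum>p\<in>K. B \<alpha> (of_int (n p * k p b) \<odot>\<^bsub>V\<^esub> fst p))"
        unfolding u_def using that v K(1) by (intro form_finsum) auto
      also have "\<dots> = (\<Sum>p\<in>K. of_int (n p * k p b) * B \<alpha> (fst p))"
        using v that by (intro sum.cong refl) (simp add: form_smult_right)
      finally show ?thesis .
    qed
    have rational: "B \<alpha> u = 0" if \<alpha>: "\<alpha> \<in> R" "rational_multiple \<alpha>" for \<alpha>
    proof -
      obtain c where "\<And>w. w \<in> int_span V R \<Longrightarrow> \<exists>q. B \<alpha> w = c * of_rat q"
        using rational_multiple_int_span[OF \<alpha>] by blast
      then obtain q where q: "\<And>w. w \<in> int_span V R \<Longrightarrow> B \<alpha> w = c * of_rat (q w)"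
        by metis
      show ?thesis
      proof (cases "c = 0")
        case True
        then show ?thesis
          unfolding form_u[OF \<alpha>(1)] using q v by (intro sum.neutral) simp
      next
        case False
        \<comment> \<open>Dividing by \<open>c\<close> leaves a relation with rational weights, to
          which the coordinate at \<open>b\<close> applies term by term.\<close>
        have "c * (\<Sum>p\<in>K. of_rat (of_int (n p) * q (fst p)) * snd p) =
            (\<Sum>p\<in>K. of_int (n p) * snd p * B \<alpha> (fst p))"
          unfolding sum_distrib_left using q v
          by (intro sum.cong refl) (simp add: of_rat_mult mult_ac)
        then have "(\<Sum>p\<in>K. of_rat (of_int (n p) * q (fst p)) * snd p) = 0"
          using form_eval[OF \<alpha>(1)] False by simp
        then have *: "(\<Sum>p\<in>K. (of_int (n p) * q (fst p)) * coord (snd p) b) = 0"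
          using coord_sum[OF K(1), of "\<lambda>p. of_int (n p) * q (fst p)" snd b] coord_scale[of 0 0 b] by simp
        \<comment> \<open>Up to the factor \<open>c\<close> times \<open>D\<close>, this pairing is
          the vanishing coordinate sum just obtained.\<close>
        have "B \<alpha> u = (\<Sum>p\<in>K. c * of_rat (of_int D * ((of_int (n p) * q (fst p)) * coord (snd p) b)))"
          unfolding form_u[OF \<alpha>(1)]
        proof (rule sum.cong[OF refl])
          fix p assume p: "p \<in> K"
          have "(of_int (k p b) :: complex) = of_rat (of_int D * coord (snd p) b)"
            using k[OF p b] by (metis of_rat_of_int_eq)
          then show "of_int (n p * k p b) * B \<alpha> (fst p) =
              c * of_rat (of_int D * ((of_int (n p) * q (fst p)) * coord (snd p) b))"
            using q[OF v(1)[OF p]] by (simp add: of_rat_mult mult_ac)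
        qed
        also have "\<dots> = c * of_rat (of_int D * (\<Sum>p\<in>K. (of_int (n p) * q (fst p)) * coord (snd p) b))"
          by (simp only: sum_distrib_left of_rat_sum)
        finally show ?thesis
          by (simp only: *) simp
      qed
    qed
    have "B \<alpha> u = 0" if \<alpha>: "\<alpha> \<in> R" for \<alpha>
    proof (cases "rational_multiple \<alpha>")
      case False
      \<comment> \<open>Such a root is isotropic, and its functional is a combination of those of
        three nonisotropic roots, which vanish at \<open>u\<close> already.\<close>
      then have "B \<alpha> \<alpha> = 0"
        using nonisotropic_rational_multiple \<alpha> by blast
      then show ?thesis
        using isotropic_root_functional[OF \<alpha> _ False] rational nonisotropic_rational_multiple u
        by (metis add_0 mult_zero_right)
    qed (rule rational[OF \<alpha>])
    then have "u = \<zero>\<^bsub>V\<^esub>"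
      using u form_sym[OF u]
      by (intro nondegenerate_eqI[OF nondeg roots_subset span_roots]) (auto simp: form_zero_left)
    then show ?thesis
      by (simp add: u_def)
  qed
  then have "(\<Sum>b\<in>P. frag_of (\<Oplus>\<^bsub>V\<^esub>p\<in>K. of_int (n p * k p b) \<odot>\<^bsub>V\<^esub> fst p, b / of_int D)) \<in> null_sums R"
    by (intro null_sums_sum[OF roots_subset]) (simp add: null_sums_zero_left[OF roots_subset])
  from null_sums_add[OF roots_subset collected this] show ?thesis
    by simp
qed

lemma canonical_map_bij:
  assumes "nondegenerate V B"
  shows "bij_betw (canonical_map V) (carrier (complexification V R)) (carrier V)"
  using null_sumsI[OF assms] by (intro canonical_map_bij_betw[OF roots_subset span_roots])

end


section \<open>The quotient by the kernel of the form\<close>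

context complex_form_space
begin

abbreviation Vq where "Vq \<equiv> quotient_space V (form_kernel V B)"
abbreviation Bq where "Bq \<equiv> quotient_form B"
abbreviation proj where "proj \<equiv> quotient_map V (form_kernel V B)"

lemma kernel_abelian_subgroup: "abelian_subgroup (form_kernel V B) V"
proof (rule abelian_subgroupI3)
  show "additive_subgroup (form_kernel V B) V"
  proof (rule additive_subgroupI, rule group.subgroupI[OF module.M.a_group])
    have "\<zero>\<^bsub>V\<^esub> \<in> form_kernel V B"
      by (simp add: form_kernel_def form_zero_left)
    then show "form_kernel V B \<noteq> {}"
      by auto
  qed (auto simp: form_kernel_def form_add form_uminus a_inv_def[symmetric])
qed (rule module.M.abelian_group_axioms)

lemma kernel_smult: "k \<in> form_kernel V B \<Longrightarrow> c \<odot>\<^bsub>V\<^esub> k \<in> form_kernel V B"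
  by (simp add: form_kernel_def form_smult)

text \<open>Equal pairings mean that the difference lies in the kernel; this replaces comparison of
  cosets by comparison of numbers.\<close>

lemma proj_eq_iff:
  assumes "v \<in> carrier V" "w \<in> carrier V"
  shows "proj v = proj w \<longleftrightarrow> (\<forall>u\<in>carrier V. B v u = B w u)"
proof -
  interpret K: abelian_subgroup "form_kernel V B" V
    by (rule kernel_abelian_subgroup)
  have "proj v = proj w \<longleftrightarrow> v \<in> form_kernel V B +>\<^bsub>V\<^esub> w"
    unfolding quotient_map_def using assms K.a_repr_independence' K.a_repr_independenceD by metis
  also have "\<dots> \<longleftrightarrow> v \<ominus>\<^bsub>V\<^esub> w \<in> form_kernel V B"
    using assms K.a_rcos_module by (simp add: a_minus_def)
  also have "\<dots> \<longleftrightarrow> (\<forall>u\<in>carrier V. B v u = B w u)"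
    using assms by (simp add: form_kernel_def form_minus del: K.a_Hcarr)
  finally show ?thesis .
qed

lemma quotient_carrier: "carrier Vq = proj ` carrier V"
  by (auto simp: quotient_space_def quotient_map_def A_RCOSETS_def')

lemma quotient_add: "\<lbrakk>v \<in> carrier V; w \<in> carrier V\<rbrakk> \<Longrightarrow> proj v \<oplus>\<^bsub>Vq\<^esub> proj w = proj (v \<oplus>\<^bsub>V\<^esub> w)"
  using abelian_subgroup.a_rcos_sum[OF kernel_abelian_subgroup]
  by (simp add: quotient_space_def quotient_map_def)

lemma quotient_zero: "\<zero>\<^bsub>Vq\<^esub> = proj \<zero>\<^bsub>V\<^esub>"
proof -
  interpret K: abelian_subgroup "form_kernel V B" V
    by (rule kernel_abelian_subgroup)
  show ?thesis
    using K.a_rcos_const[OF K.zero_closed] by (simp add: quotient_space_def quotient_map_def)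
qed

lemma quotient_smult:
  assumes "v \<in> carrier V"
  shows "c \<odot>\<^bsub>Vq\<^esub> proj v = proj (c \<odot>\<^bsub>V\<^esub> v)"
proof -
  interpret K: abelian_subgroup "form_kernel V B" V
    by (rule kernel_abelian_subgroup)
  have coset: "proj u = (\<lambda>k. k \<oplus>\<^bsub>V\<^esub> u) ` form_kernel V B" for u
    by (auto simp: quotient_map_def a_r_coset_def')
  have smult: "c \<odot>\<^bsub>Vq\<^esub> proj v =
      (\<lambda>p. fst p \<oplus>\<^bsub>V\<^esub> c \<odot>\<^bsub>V\<^esub> (snd p \<oplus>\<^bsub>V\<^esub> v)) ` (form_kernel V B \<times> form_kernel V B)"
    unfolding coset by (force simp: quotient_space_def set_add_def')
  \<comment> \<open>The two kernel elements merge into k + c l, which is again in the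
    kernel.\<close>
  have dist: "k \<oplus>\<^bsub>V\<^esub> c \<odot>\<^bsub>V\<^esub> (l \<oplus>\<^bsub>V\<^esub> v) = (k \<oplus>\<^bsub>V\<^esub> c \<odot>\<^bsub>V\<^esub> l) \<oplus>\<^bsub>V\<^esub> c \<odot>\<^bsub>V\<^esub> v"
    if "k \<in> form_kernel V B" "l \<in> form_kernel V B" for k l
    using that assms K.a_Hcarr by (simp add: module.smult_r_distr[simplified] module.M.a_assoc)
  show ?thesis
  proof (intro equalityI subsetI)
    fix y assume "y \<in> c \<odot>\<^bsub>Vq\<^esub> proj v"
    then obtain p where p: "y = fst p \<oplus>\<^bsub>V\<^esub> c \<odot>\<^bsub>V\<^esub> (snd p \<oplus>\<^bsub>V\<^esub> v)"
      "p \<in> form_kernel V B \<times> form_kernel V B"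
      unfolding smult by (rule imageE)
    then have kl: "fst p \<in> form_kernel V B" "snd p \<in> form_kernel V B"
      by (simp_all add: mem_Times_iff)
    show "y \<in> proj (c \<odot>\<^bsub>V\<^esub> v)"
      unfolding coset p(1) dist[OF kl] using kl by (intro imageI K.a_closed kernel_smult)
  next
    fix y assume "y \<in> proj (c \<odot>\<^bsub>V\<^esub> v)"
    \<comment> \<open>The summand \<open>k\<close> alone reaches the whole coset, with 0 for the
      other kernel element; this works for the scalar 0 as well.\<close>
    then obtain k where k: "k \<in> form_kernel V B" "y = k \<oplus>\<^bsub>V\<^esub> c \<odot>\<^bsub>V\<^esub> (\<zero>\<^bsub>V\<^esub> \<oplus>\<^bsub>V\<^esub> v)"
      unfolding coset using assms by (elim imageE) (rule that, assumption, simp)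
    then show "y \<in> c \<odot>\<^bsub>Vq\<^esub> proj v"
      unfolding smult by (intro image_eqI[of _ _ "(k, \<zero>\<^bsub>V\<^esub>)"] SigmaI K.zero_closed) simp_all
  qed
qed

text \<open>Shifting both arguments by kernel elements does not change the pairing, so
  \<open>the_elem\<close> is applied to a singleton.\<close>

lemma quotient_form_proj:
  assumes "v \<in> carrier V" "w \<in> carrier V"
  shows "Bq (proj v) (proj w) = B v w"
proof -
  interpret K: abelian_subgroup "form_kernel V B" V
    by (rule kernel_abelian_subgroup)
  have coset: "proj u = (\<lambda>k. k \<oplus>\<^bsub>V\<^esub> u) ` form_kernel V B" for u
    by (auto simp: quotient_map_def a_r_coset_def')
  have null: "B k u = 0" "B u k = 0" if "k \<in> form_kernel V B" "u \<in> carrier V" for k u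
    using that form_sym[of u k] by (auto simp: form_kernel_def simp del: K.a_Hcarr)
  have "B (k \<oplus>\<^bsub>V\<^esub> v) (l \<oplus>\<^bsub>V\<^esub> w) = B v w" if "k \<in> form_kernel V B" "l \<in> form_kernel V B" for k l
    using that assms K.a_Hcarr by (simp add: form_add form_add_right null)
  then have const: "B x y = B v w" if "x \<in> proj v" "y \<in> proj w" for x y
    using that unfolding coset by (elim imageE) (simp only:)
  have "v \<in> proj v" "w \<in> proj w"
    using assms K.a_rcos_self by (simp_all add: quotient_map_def)
  note mem = this
  have "{B x y | x y. x \<in> proj v \<and> y \<in> proj w} = {B v w}"
  proof (intro equalityI subsetI)
    fix z assume "z \<in> {B x y | x y. x \<in> proj v \<and> y \<in> proj w}"
    then obtain x y where "x \<in> proj v" "y \<in> proj w" "z = B x y"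
      by (elim CollectE exE conjE) (rule that)
    then show "z \<in> {B v w}"
      using const[of x y] by simp
  next
    fix z assume "z \<in> {B v w}"
    then have "z = B v w"
      by simp
    then show "z \<in> {B x y | x y. x \<in> proj v \<and> y \<in> proj w}"
      by (intro CollectI exI conjI) (assumption, (rule mem)+)
  qed
  then show ?thesis
    by (simp add: quotient_form_def)
qed

lemma quotient_vectorspace: "vectorspace class_ring Vq"
proof (rule vs_criteria)
  show "field (class_ring :: complex ring)"
    by (rule vectorspace.axioms(2)[OF vectorspace_axioms])
  show "\<forall>v\<in>carrier Vq. \<exists>w\<in>carrier Vq. v \<oplus>\<^bsub>Vq\<^esub> w = \<zero>\<^bsub>Vq\<^esub>"
  proof
    fix X assume "X \<in> carrier Vq"
    then obtain v where v: "v \<in> carrier V" "X = proj v"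
      by (auto simp: quotient_carrier)
    then show "\<exists>w\<in>carrier Vq. X \<oplus>\<^bsub>Vq\<^esub> w = \<zero>\<^bsub>Vq\<^esub>"
      by (intro bexI[of _ "proj (\<ominus>\<^bsub>V\<^esub> v)"])
        (auto simp: quotient_add quotient_zero quotient_carrier module.M.r_neg)
  qed
qed (auto simp: quotient_carrier quotient_add quotient_zero quotient_smult module.M.a_ac
    module.smult_assoc1[simplified] module.smult_one[simplified]
    module.smult_r_distr[simplified] module.smult_l_distr[simplified])

text \<open>The vectors whose class lies in the span of the image form a submodule that contains
  \<open>S\<close>.\<close>

lemma quotient_span:
  assumes S: "S \<subseteq> carrier V" "span S = carrier V"
  shows "LinearCombinations.module.span class_ring Vq (proj ` S) = carrier Vq"
proof -
  interpret Q: vectorspace class_ring Vq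
    by (rule quotient_vectorspace)
  have sub: "proj ` S \<subseteq> carrier Vq"
    using S by (auto simp: quotient_carrier)
  have Qsub: "LinearCombinations.submodule class_ring (Q.span (proj ` S)) Vq"
    by (rule Q.span_is_submodule[OF sub])
  have "LinearCombinations.submodule class_ring {v \<in> carrier V. proj v \<in> Q.span (proj ` S)} V"
    using LinearCombinations.submodule.m_closed[OF Qsub] LinearCombinations.submodule.zero_closed[OF Qsub]
      LinearCombinations.submodule.smult_closed[OF Qsub]
    by (auto simp: LinearCombinations.submodule_def module.module_axioms quotient_zero
        quotient_add[symmetric] quotient_smult[symmetric])
  then have "span S \<subseteq> {v \<in> carrier V. proj v \<in> Q.span (proj ` S)}"
    using S(1) Q.in_own_span[OF sub] by (intro span_is_subset) auto
  then show ?thesis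
    using S(2) Q.span_is_subset2[OF sub] by (auto simp: quotient_carrier)
qed

lemma quotient_complex_form_space: "complex_form_space Vq Bq"
proof -
  interpret Q: vectorspace class_ring Vq
    by (rule quotient_vectorspace)
  obtain A where A: "finite A" "A \<subseteq> carrier V" "span A = carrier V"
    using finite_spanning_subset[of "carrier V"] span_is_subset2[of "carrier V"] in_own_span[of "carrier V"]
    by (metis subset_refl subset_antisym)
  have "Q.fin_dim"
    unfolding Q.fin_dim_def using A quotient_span[OF A(2,3)]
    by (intro exI[of _ "proj ` A"]) (auto simp: quotient_carrier)
  then show ?thesis
    by unfold_locales
      (auto simp: quotient_carrier quotient_add quotient_smult quotient_form_proj form_add form_smult intro: form_sym)
qed

lemma quotient_nondegenerate: "nondegenerate Vq Bq"
proof -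
  have "proj v = proj \<zero>\<^bsub>V\<^esub>" if v: "v \<in> carrier V" "\<forall>w\<in>carrier V. B v w = 0" for v
    using v by (simp add: proj_eq_iff form_zero_left)
  then have "form_kernel Vq Bq \<subseteq> {proj \<zero>\<^bsub>V\<^esub>}"
    unfolding form_kernel_def[of Vq] quotient_carrier using quotient_form_proj by force
  moreover have "proj \<zero>\<^bsub>V\<^esub> \<in> form_kernel Vq Bq"
    unfolding form_kernel_def[of Vq] quotient_carrier by (simp add: quotient_form_proj form_zero_left)
  ultimately show ?thesis
    unfolding nondegenerate_def quotient_zero by blast
qed

lemma quotient_uminus:
  assumes "v \<in> carrier V"
  shows "\<ominus>\<^bsub>Vq\<^esub> proj v = proj (\<ominus>\<^bsub>V\<^esub> v)"
proof -
  interpret Q: vectorspace class_ring Vq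
    by (rule quotient_vectorspace)
  show ?thesis
    using assms by (intro Q.module.M.minus_equality)
      (auto simp: quotient_carrier quotient_add quotient_zero module.M.l_neg)
qed

lemma quotient_minus:
  "\<lbrakk>v \<in> carrier V; w \<in> carrier V\<rbrakk> \<Longrightarrow> proj v \<ominus>\<^bsub>Vq\<^esub> proj w = proj (v \<ominus>\<^bsub>V\<^esub> w)"
  by (simp add: a_minus_def quotient_uminus quotient_add)

lemma quotient_reflection:
  "\<lbrakk>u \<in> carrier V; v \<in> carrier V\<rbrakk> \<Longrightarrow> reflection Vq Bq (proj u) (proj v) = proj (reflection V B u v)"
  by (simp add: reflection_def quotient_form_proj quotient_smult quotient_minus)

lemma quotient_int_span:
  assumes S: "S \<subseteq> carrier V" and "v \<in> int_span V S"
  shows "proj v \<in> int_span Vq (proj ` S)"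
  using assms(2) unfolding int_span_def
proof (induction v rule: generate.induct)
  case one
  then show ?case
    using generate.one[of "add_monoid Vq"] by (simp add: quotient_zero)
next
  case (incl h)
  then show ?case
    by (intro generate.incl imageI)
next
  case (inv h)
  then have "inv\<^bsub>add_monoid Vq\<^esub> proj h \<in> generate (add_monoid Vq) (proj ` S)"
    by (intro generate.inv imageI)
  moreover have "inv\<^bsub>add_monoid Vq\<^esub> proj h = proj (inv\<^bsub>add_monoid V\<^esub> h)"
    using quotient_uminus[of h] inv S by (auto simp: a_inv_def)
  ultimately show ?case
    by simp
next
  case (eng h1 h2)
  then have "h1 \<in> carrier V" "h2 \<in> carrier V"
    using int_span_closed[OF S] by (simp_all add: int_span_def)
  then show ?case
    using generate.eng[OF eng.IH] by (simp add: quotient_add)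
qed

end

section \<open>The image of a generalized reflection root system\<close>

context grrs
begin

lemma span_eq_carrier: "span R = carrier V"
  using GR1 span_of_canonical_map[OF subset_carrier] by (simp add: bij_betw_def)

text \<open>The new map applies \<open>r\<close> to a chosen root of each class. Several roots may
  share a class, so the result can depend on the choice and bijectivity is not claimed; this matches
  (WGR3).\<close>

lemma quotient_isotropic_reflection:
  assumes \<alpha>: "\<alpha> \<in> R" "B \<alpha> \<alpha> = 0"
  shows "\<exists>r. isotropic_reflection Vq Bq (proj ` R) (proj \<alpha>) r"
proof -
  obtain r where r: "isotropic_reflection V B R \<alpha> r"
    using GR3[OF \<alpha>] by blast
  have carr: "\<beta> \<in> carrier V" if "\<beta> \<in> R" for \<beta>
    using that subset_carrier by auto
  have rR: "r \<beta> \<in> R" if "\<beta> \<in> R" for \<beta>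
    using r that by (auto simp: isotropic_reflection_def)
  have neg: "\<ominus>\<^bsub>V\<^esub> \<alpha> \<in> R"
    using rR[OF \<alpha>(1)] r by (simp add: isotropic_reflection_def)
  define lift where "lift X = (SOME \<beta>. \<beta> \<in> R \<and> proj \<beta> = X)" for X
  have lift: "lift X \<in> R" "proj (lift X) = X" if "X \<in> proj ` R" for X
    using that someI_ex[of "\<lambda>\<beta>. \<beta> \<in> R \<and> proj \<beta> = X"] by (auto simp: lift_def)
  \<comment> \<open>The classes of \<plusminus>\<alpha> are treated apart: another root in one of
    them is orthogonal to \<alpha>, so \<open>r\<close> would fix it instead of swapping the
    classes.\<close>
  define r' where "r' X = (if X = proj \<alpha> then proj (\<ominus>\<^bsub>V\<^esub> \<alpha>)
    else if X = proj (\<ominus>\<^bsub>V\<^esub> \<alpha>) then proj \<alpha> else proj (r (lift X)))" for X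
  \<comment> \<open>If the classes agreed, \<alpha> would lie in the kernel, against (GR0).\<close>
  have ne: "proj (\<ominus>\<^bsub>V\<^esub> \<alpha>) \<noteq> proj \<alpha>"
  proof
    assume "proj (\<ominus>\<^bsub>V\<^esub> \<alpha>) = proj \<alpha>"
    then have "\<forall>u\<in>carrier V. B \<alpha> u = 0"
      using carr[OF \<alpha>(1)] by (simp add: proj_eq_iff form_uminus)
    then show False
      using GR0 \<alpha>(1) carr by (auto simp: form_kernel_def)
  qed
  have maps: "r' \<in> proj ` R \<rightarrow> proj ` R"
    using rR lift neg \<alpha> by (auto simp: r'_def)
  have swap: "r' (proj \<alpha>) = \<ominus>\<^bsub>Vq\<^esub> proj \<alpha>" "r' (\<ominus>\<^bsub>Vq\<^esub> proj \<alpha>) = proj \<alpha>"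
    using ne carr[OF \<alpha>(1)] by (simp_all add: r'_def quotient_uminus)
  have fixed: "r' X = X"
    if X: "X \<in> proj ` R" "X \<noteq> proj \<alpha>" "X \<noteq> \<ominus>\<^bsub>Vq\<^esub> proj \<alpha>" "Bq (proj \<alpha>) X = 0" for X
  proof -
    have "lift X \<noteq> \<alpha>" "lift X \<noteq> \<ominus>\<^bsub>V\<^esub> \<alpha>"
      using X lift[OF X(1)] quotient_uminus[OF carr[OF \<alpha>(1)]] by metis+
    moreover have "B \<alpha> (lift X) = 0"
      using X(4) lift[OF X(1)] carr \<alpha> quotient_form_proj[of \<alpha> "lift X"] by simp
    ultimately have "r (lift X) = lift X"
      using r lift[OF X(1)] by (simp add: isotropic_reflection_def)
    then show ?thesis
      using X lift[OF X(1)] carr[OF \<alpha>(1)] by (simp add: r'_def quotient_uminus)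
  qed
  have step: "r' X \<in> {X \<oplus>\<^bsub>Vq\<^esub> proj \<alpha>, X \<ominus>\<^bsub>Vq\<^esub> proj \<alpha>}"
    if X: "X \<in> proj ` R" "Bq (proj \<alpha>) X \<noteq> 0" for X
  proof -
    have B: "B \<alpha> (lift X) \<noteq> 0"
      using X lift[OF X(1)] carr \<alpha> quotient_form_proj[of \<alpha> "lift X"] by simp
    then have "r (lift X) \<in> {lift X \<oplus>\<^bsub>V\<^esub> \<alpha>, lift X \<ominus>\<^bsub>V\<^esub> \<alpha>}"
      using r lift[OF X(1)] by (simp add: isotropic_reflection_def)
    then have "proj (r (lift X)) \<in> {X \<oplus>\<^bsub>Vq\<^esub> proj \<alpha>, X \<ominus>\<^bsub>Vq\<^esub> proj \<alpha>}"
      using lift[OF X(1)] carr \<alpha> quotient_add[of "lift X" \<alpha>] quotient_minus[of "lift X" \<alpha>] by auto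
    \<comment> \<open>The classes of \<plusminus>\<alpha> are orthogonal to that of \<alpha>, so
      \<open>r'\<close> takes its last branch here.\<close>
    moreover have "X \<noteq> proj \<alpha>" "X \<noteq> proj (\<ominus>\<^bsub>V\<^esub> \<alpha>)"
      using X(2) \<alpha> carr[OF \<alpha>(1)] form_uminus[of \<alpha> \<alpha>] form_sym[of \<alpha> "\<ominus>\<^bsub>V\<^esub> \<alpha>"]
      by (auto simp: quotient_form_proj)
    ultimately show ?thesis
      by (simp add: r'_def)
  qed
  show ?thesis
    unfolding isotropic_reflection_def
  proof (intro exI[of _ r'] conjI ballI impI)
    show "r' X = X" if "X \<in> proj ` R" "X \<noteq> proj \<alpha> \<and> X \<noteq> \<ominus>\<^bsub>Vq\<^esub> proj \<alpha> \<and> Bq (proj \<alpha>) X = 0" for X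
      using fixed that by simp
  qed (fact maps swap step)+
qed

lemma quotient_spanning_roots: "spanning_roots Vq Bq (proj ` R)"
proof -
  interpret Q: complex_form_space Vq Bq
    by (rule quotient_complex_form_space)
  have carr: "\<beta> \<in> carrier V" if "\<beta> \<in> R" for \<beta>
    using that subset_carrier by auto
  show ?thesis
  proof
    show "proj ` R \<subseteq> carrier Vq"
      using carr by (auto simp: quotient_carrier)
    show "Q.span (proj ` R) = carrier Vq"
      by (rule quotient_span[OF subset_carrier span_eq_carrier])
    show "\<exists>r. isotropic_reflection Vq Bq (proj ` R) X r" if "X \<in> proj ` R" "Bq X X = 0" for X
      using that quotient_isotropic_reflection carr by (auto simp: quotient_form_proj)
    show "reflection Vq Bq X ` proj ` R = proj ` R \<and>
        (\<forall>Y\<in>proj ` R. Y \<ominus>\<^bsub>Vq\<^esub> reflection Vq Bq X Y \<in> int_span Vq {X})"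
      if X: "X \<in> proj ` R" "Bq X X \<noteq> 0" for X
    proof -
      obtain \<alpha> where \<alpha>: "\<alpha> \<in> R" "X = proj \<alpha>"
        using X by auto
      then have nz: "B \<alpha> \<alpha> \<noteq> 0"
        using X carr by (simp add: quotient_form_proj)
      have refl: "reflection V B \<alpha> \<beta> \<in> R" "\<beta> \<ominus>\<^bsub>V\<^esub> reflection V B \<alpha> \<beta> \<in> int_span V {\<alpha>}" if "\<beta> \<in> R" for \<beta>
        using GR2[OF \<alpha>(1) nz] that by auto
      have "reflection Vq Bq X ` proj ` R = proj ` (reflection V B \<alpha> ` R)"
        unfolding image_image using \<alpha> carr by (intro image_cong) (simp_all add: quotient_reflection)
      then have "reflection Vq Bq X ` proj ` R = proj ` R"
        using GR2[OF \<alpha>(1) nz] by simp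
      moreover have "Y \<ominus>\<^bsub>Vq\<^esub> reflection Vq Bq X Y \<in> int_span Vq {X}" if Y: "Y \<in> proj ` R" for Y
      proof -
        obtain \<beta> where \<beta>: "\<beta> \<in> R" "Y = proj \<beta>"
          using Y by auto
        have "Y \<ominus>\<^bsub>Vq\<^esub> reflection Vq Bq X Y = proj (\<beta> \<ominus>\<^bsub>V\<^esub> reflection V B \<alpha> \<beta>)"
          using \<alpha> \<beta> carr refl by (simp add: quotient_reflection quotient_minus)
        then show ?thesis
          using quotient_int_span[of "{\<alpha>}", OF _ refl(2)[OF \<beta>(1)]] \<alpha> carr by simp
      qed
      ultimately show ?thesis
        by blast
    qed
  qed
qed

text \<open>The bijection in (GR1) is not pushed forward from \<open>V\<close> but proved afresh
  from nondegeneracy of the induced form.\<close>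

theorem quotient_wgrs: "wgrs Vq Bq (proj ` R)"
proof -
  interpret Q: spanning_roots Vq Bq "proj ` R"
    by (rule quotient_spanning_roots)
  show ?thesis
  proof
    have "proj \<alpha> \<notin> form_kernel Vq Bq" if \<alpha>: "\<alpha> \<in> R" for \<alpha>
    proof
      assume "proj \<alpha> \<in> form_kernel Vq Bq"
      then have "B \<alpha> w = 0" if "w \<in> carrier V" for w
        using that \<alpha> subset_carrier quotient_form_proj[of \<alpha> w]
        by (auto simp: form_kernel_def[of Vq] quotient_carrier)
      then have "\<alpha> \<in> form_kernel V B"
        using \<alpha> subset_carrier by (auto simp: form_kernel_def)
      then show False
        using GR0 \<alpha> by blast
    qed
    then show "form_kernel Vq Bq \<inter> proj ` R = {}"
      by auto
    show "proj ` R \<noteq> {}"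
      using nonempty by simp
  qed (rule Q.roots_subset Q.canonical_map_bij[OF quotient_nondegenerate] quotient_nondegenerate
      Q.reflection_roots Q.isotropic_roots; assumption)+
qed

text \<open>Irreducibility passes to the image, since the preimages of an orthogonal decomposition
  of the image decompose \<open>R\<close> orthogonally.\<close>

theorem quotient_finite:
  assumes irr: "\<not> reducible B R" and iso: "\<exists>\<alpha>\<in>R. B \<alpha> \<alpha> = 0"
  shows "finite (proj ` R)"
proof -
  interpret Q: spanning_roots Vq Bq "proj ` R"
    by (rule quotient_spanning_roots)
  have carr: "\<beta> \<in> carrier V" if "\<beta> \<in> R" for \<beta>
    using that subset_carrier by auto
  show ?thesis
  proof (rule Q.finite_roots[OF quotient_nondegenerate])
    show "\<exists>X\<in>proj ` R. Bq X X = 0"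
      using iso carr by (auto simp: quotient_form_proj)
    show "\<not> reducible Bq (proj ` R)"
    proof
      assume "reducible Bq (proj ` R)"
      then obtain R1 R2 where R12: "proj ` R = R1 \<union> R2" "R1 \<noteq> {}" "R2 \<noteq> {}"
        "\<forall>X\<in>R1. \<forall>Y\<in>R2. Bq X Y = 0"
        unfolding reducible_def by (elim exE conjE) (rule that)
      define S where "S T = {\<beta> \<in> R. proj \<beta> \<in> T}" for T
      have "R1 \<subseteq> proj ` R" "R2 \<subseteq> proj ` R"
        using R12(1) by simp_all
      then have "S R1 \<noteq> {}" "S R2 \<noteq> {}"
        using R12(2,3) unfolding S_def by blast+
      moreover have "R = S R1 \<union> S R2"
        using R12(1) unfolding S_def by blast
      moreover have "B \<alpha> \<beta> = 0" if "\<alpha> \<in> S R1" "\<beta> \<in> S R2" for \<alpha> \<beta>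
        using that bspec[OF bspec[OF R12(4)], of "proj \<alpha>" "proj \<beta>"] carr by (simp add: S_def quotient_form_proj)
      ultimately have "reducible B R"
        unfolding reducible_def by blast
      then show False
        using irr by contradiction
    qed
  qed
qed

end

theorem corollary2p1p1:
  fixes V :: "(complex, 'v) module" and B :: "'v \<Rightarrow> 'v \<Rightarrow> complex" and R :: "'v set"
  assumes "complex_form_space V B"
    and "grrs V B R"
  shows "wgrs (quotient_space V (form_kernel V B)) (quotient_form B)
           (quotient_map V (form_kernel V B) ` R) \<and>
         (\<not> reducible B R \<and> (\<exists>\<alpha> \<in> R. B \<alpha> \<alpha> = 0) \<longrightarrow> finite R \<or> affine_grrs V B R)"
  \<comment> \<open>If \<open>R\<close> is infinite, finiteness of its image is exactly what being
    affine still demands.\<close>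
  using grrs.quotient_wgrs[OF assms(2)] grrs.quotient_finite[OF assms(2)] assms(2)
  by (auto simp: affine_grrs_def)

end
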